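(* Let $n\ge r\ge 3$ be integers and let $\mathcal{H}$ be a connected $r$-uniform hypergraph on $n$ vertices. Then $$\sum_{e\in E(\mathcal{H})}\frac{1}{f_r(p_{\mathcal{H}}(e))}\le n.$$ Moreover, equality holds if and only if one of the following holds: (i) $n=r+1$ and $|E(\mathcal{H})|\in\{1,2,\ldots,r-1,r+1\}$; (ii) $n\neq r+1$ and $\mathcal{H}$ is the complete $r$-uniform hypergraph on $n$ vertices, i.e. $|E(\mathcal{H})|=\binom{n}{r}$.
   Context: Hypergraphs are simple (edges are distinct subsets of the vertex set); an $r$-uniform hypergraph has all edges of size $r$. A Berge path of length $k$ is an alternating sequence $v_0e_1v_1e_2\cdots v_{k-1}e_kv_k$ of distinct vertices $v_0,\dots,v_k$ and distinct edges $e_1,\dots,e_k$ with $v_{i-1},v_i\in e_i$ for all $i$; $e_1,\dots,e_k$ are its defining edges. A hypergraph is connected if every pair of distinct vertices are the two terminal vertices of some Berge path. For an edge $e$, $p_{\mathcal{H}}(e)$ is the maximum $k$ such that $e$ is a defining edge of some Berge path of length $k$ in $\mathcal{H}$. For $r\ge 3$ and real $x\ge1$, $f_r(x)=\frac1r$ if $x=1$, $f_r(x)=\frac{x}{r+1}$ if $1<x\le r-1$, and $f_r(x)=\frac1r\binom{x}{r-1}$ if $x\ge r$. *)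

theory Defs
  imports Complex_Main
begin

definition hypergraph :: "'a set \<Rightarrow> 'a set set \<Rightarrow> bool" where
  "hypergraph V E \<longleftrightarrow> finite V \<and> E \<subseteq> Pow V"

definition uniform_hypergraph :: "nat \<Rightarrow> 'a set \<Rightarrow> 'a set set \<Rightarrow> bool" where
  "uniform_hypergraph r V E \<longleftrightarrow> hypergraph V E \<and> (\<forall>e\<in>E. card e = r)"

(* The path v_0 e_1 v_1 ... e_k v_k is given by vs = [v_0, ..., v_k] and es = [e_1, ..., e_k],
   so es ! i is the edge e_(i+1), and the length k of the path is length es. *)
definition berge_path :: "'a set \<Rightarrow> 'a set set \<Rightarrow> 'a list \<Rightarrow> 'a set list \<Rightarrow> bool" where
  "berge_path V E vs es \<longleftrightarrow>
     length vs = Suc (length es) \<and>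
     set vs \<subseteq> V \<and> set es \<subseteq> E \<and>
     distinct vs \<and> distinct es \<and>
     (\<forall>i<length es. vs ! i \<in> es ! i \<and> vs ! Suc i \<in> es ! i)"

definition hypergraph_connected :: "'a set \<Rightarrow> 'a set set \<Rightarrow> bool" where
  "hypergraph_connected V E \<longleftrightarrow>
     (\<forall>u\<in>V. \<forall>v\<in>V. u \<noteq> v \<longrightarrow>
        (\<exists>vs es. berge_path V E vs es \<and> hd vs = u \<and> last vs = v))"

(* For finite V the set is finite (k < card V), and it contains 1 as soon as e has two vertices. *)
definition max_berge_length :: "'a set \<Rightarrow> 'a set set \<Rightarrow> 'a set \<Rightarrow> nat" where
  "max_berge_length V E e =
     Max {k. \<exists>vs es. berge_path V E vs es \<and> length es = k \<and> e \<in> set es}"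

(* The function is left unspecified for x < 1 and in the gap r - 1 < x < r, which contains
   no integer. *)
definition weight_fn :: "nat \<Rightarrow> real \<Rightarrow> real" where
  "weight_fn r x =
     (if x = 1 then 1 / real r
      else if 1 < x \<and> x \<le> real r - 1 then x / (real r + 1)
      else if x \<ge> real r then (x gchoose (r - 1)) / real r
      else undefined)"

definition complete_uniform_edges :: "nat \<Rightarrow> 'a set \<Rightarrow> 'a set set" where
  "complete_uniform_edges r V = {e. e \<subseteq> V \<and> card e = r}"

end

theory Submission
  imports Defs
begin

text \<open>The inequality holds for all uniform hypergraphs, connected or not, by induction on the number of
  vertices. Let k be the maximal length of a Berge path. It suffices to find a nonempty vertex set S such
  that all edges meeting S lie on a path of length k and there are at most f(k) |S| of them: deleting S
  leaves the sum over the remaining edges bounded by |V - S|, because p can only drop in a subhypergraph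
  and f is increasing. If there is a Berge cycle with k + 1 vertices, S is its vertex set; all edges
  meeting S are then contained in S. Otherwise, for k at most r every edge at an end of a longest path is
  one of its defining edges, and S is the vertex set covered by a cycle of length k, or the set of the ends
  that a fixed path admits, or the set of outer vertices of an edge attached to a cycle of length k - 1.
  For k greater than r, the absence of a cycle forces the neighbourhoods of the two ends to be small, and
  S consists of one or two ends (or three ends when r = 3 and k = 5).

  In the case of equality every vertex starts a path of length p(e) through some edge e. Hence an edge
  between S and the rest would prolong such a path and make the inequality strict; so S = V for a
  connected hypergraph.\<close>

section \<open>Berge paths and the weight function\<close>

text \<open>The values of f are edge counts per vertex: an isolated edge has 1/r, k edges spread
  over r + 1 vertices have k/(r + 1), and the complete hypergraph on k + 1 vertices has (k choose (r
  - 1))/r. At k = r the value is 1, more than r/(r + 1); hence k = r can be treated together with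
  the smaller k.

  For k greater than r the tool is rotation: an edge from the first vertex into the path replaces a
  path edge, an initial segment is reversed, and another vertex becomes the end. Edges from the two
  ends that cross would close a cycle with k + 1 vertices. So the two neighbourhoods, one of them
  shifted by one position, are disjoint, and the smaller has at most k/2 vertices. This yields an
  end of small degree, except that for r = 3 and k = 5 the degree bound is 4 while f(5) = 10/3.

  The equality information is requested from S only when S = V. For a proper S, tightness excludes
  edges between S and its complement, and both sides are smaller hypergraphs to which the induction
  applies.\<close>

fun links :: "'a list \<Rightarrow> 'a set list \<Rightarrow> bool" where
  "links [v] [] = True"
| "links (u # v # vs) (e # es) = (u \<in> e \<and> v \<in> e \<and> links (v # vs) es)"
| "links _ _ = False"

lemma links_length: "links vs es \<Longrightarrow> length vs = Suc (length es)"
  by (induction vs es rule: links.induct) auto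

lemma links_iff_nth:
  "links vs es \<longleftrightarrow> length vs = Suc (length es) \<and>
     (\<forall>i<length es. vs ! i \<in> es ! i \<and> vs ! Suc i \<in> es ! i)"
proof (induction vs es rule: links.induct)
  case (2 u v vs e es)
  show ?case
    by (simp add: 2 All_less_Suc2 conj_ac)
qed auto

lemma links_append:
  "length A = Suc (length EA) \<Longrightarrow> B \<noteq> [] \<Longrightarrow>
   links (A @ B) (EA @ e # EB) \<longleftrightarrow> links A EA \<and> links B EB \<and> last A \<in> e \<and> hd B \<in> e"
proof (induction A EA rule: links.induct)
  case (1 v)
  then show ?case by (cases B) auto
qed auto

lemma links_rev_imp: "links vs es \<Longrightarrow> links (rev vs) (rev es)"
proof (induction vs es rule: links.induct)
  case (2 u v vs e es)
  then have "links (rev (v # vs) @ [u]) (rev es @ [e])"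
    by (subst links_append) (auto dest: links_length)
  then show ?case by simp
qed auto

lemma links_rev [simp]: "links (rev vs) (rev es) \<longleftrightarrow> links vs es"
  using links_rev_imp[of vs es] links_rev_imp[of "rev vs" "rev es"] by auto

lemma links_split_edge:
  assumes "links vs (EA @ e # EB)"
  obtains A B where "vs = A @ B" "length A = Suc (length EA)" "B \<noteq> []"
    "links A EA" "links B EB" "last A \<in> e" "hd B \<in> e"
proof -
  let ?A = "take (Suc (length EA)) vs" and ?B = "drop (Suc (length EA)) vs"
  have "length vs = Suc (Suc (length EA + length EB))"
    using links_length[OF assms] by simp
  then have *: "length ?A = Suc (length EA)" "?B \<noteq> []" by auto
  moreover have "links (?A @ ?B) (EA @ e # EB)" using assms by simp
  ultimately show ?thesis
    using that[of ?A ?B] links_append[OF *] by simp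
qed

lemma links_split_at:
  assumes "links (A @ B) es" "A \<noteq> []" "B \<noteq> []"
  obtains EA e EB where "es = EA @ e # EB" "length A = Suc (length EA)"
    "links A EA" "links B EB" "last A \<in> e" "hd B \<in> e"
proof -
  let ?m = "length A - 1"
  have len: "length A + length B = Suc (length es)" using links_length[OF assms(1)] by simp
  have "length A > 0" "length B > 0" using assms by auto
  then have m: "?m < length es" using len by linarith
  then have es: "es = take ?m es @ es ! ?m # drop (Suc ?m) es" by (simp add: id_take_nth_drop)
  have "length A = Suc (length (take ?m es))" using m \<open>length A > 0\<close> by simp
  moreover from this have "links A (take ?m es) \<and> links B (drop (Suc ?m) es) \<and>
      last A \<in> es ! ?m \<and> hd B \<in> es ! ?m"
    using assms es links_append[of A "take ?m es" B "es ! ?m" "drop (Suc ?m) es"] by simp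
  ultimately show ?thesis using that es by blast
qed

text \<open>\<open>links\<close> records incidence alone, so that cutting, gluing and reversing are
  plain inductions; distinctness is then argued on the underlying sets.\<close>

lemma berge_path_iff_links:
  "berge_path V E vs es \<longleftrightarrow>
     links vs es \<and> set vs \<subseteq> V \<and> set es \<subseteq> E \<and> distinct vs \<and> distinct es"
  by (auto simp: berge_path_def links_iff_nth)

lemma berge_path_rev: "berge_path V E vs es \<Longrightarrow> berge_path V E (rev vs) (rev es)"
  by (simp add: berge_path_iff_links)

lemma berge_path_length: "berge_path V E vs es \<Longrightarrow> length vs = Suc (length es)"
  by (simp add: berge_path_def)

lemma berge_path_not_Nil: "berge_path V E vs es \<Longrightarrow> vs \<noteq> []"
  by (auto simp: berge_path_def)

lemma berge_path_Cons:
  assumes "berge_path V E vs es" "v \<in> V" "v \<notin> set vs" "e \<in> E" "e \<notin> set es" "v \<in> e" "hd vs \<in> e"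
  shows "berge_path V E (v # vs) (e # es)"
  using assms by (cases vs) (auto simp: berge_path_iff_links)

lemma berge_path_mono:
  "berge_path V E vs es \<Longrightarrow> V \<subseteq> V' \<Longrightarrow> E \<subseteq> E' \<Longrightarrow> berge_path V' E' vs es"
  by (auto simp: berge_path_def)

lemma uniform_hypergraphD:
  assumes "uniform_hypergraph r V E"
  shows "finite V" "finite E" "\<And>e. e \<in> E \<Longrightarrow> e \<subseteq> V" "\<And>e. e \<in> E \<Longrightarrow> card e = r"
    "\<And>e. e \<in> E \<Longrightarrow> finite e"
  using assms unfolding uniform_hypergraph_def hypergraph_def
  by (auto intro: finite_subset[of E "Pow V"] finite_subset[of _ V])

lemma berge_path_length_less:
  assumes "finite V" "berge_path V E vs es"
  shows "length es < card V"
proof -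
  have "card (set vs) = Suc (length es)"
    using assms by (simp add: berge_path_def distinct_card)
  moreover have "card (set vs) \<le> card V"
    using assms by (intro card_mono) (auto simp: berge_path_def)
  ultimately show ?thesis by simp
qed

lemma finite_berge_lengths:
  assumes "finite V"
  shows "finite {k. \<exists>vs es. berge_path V E vs es \<and> length es = k \<and> e \<in> set es}"
  by (rule finite_subset[of _ "{..<card V}"]) (use berge_path_length_less[OF assms] in auto)

lemma max_berge_length_ge:
  assumes "finite V" "berge_path V E vs es" "e \<in> set es"
  shows "length es \<le> max_berge_length V E e"
  unfolding max_berge_length_def
  using assms by (intro Max_ge finite_berge_lengths) auto

lemma berge_path_single_edge:
  assumes "e \<in> E" "e \<subseteq> V" "u \<in> e" "v \<in> e" "u \<noteq> v"
  shows "berge_path V E [u, v] [e]"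
  using assms by (auto simp: berge_path_iff_links)

lemma max_berge_length_attained:
  assumes "uniform_hypergraph r V E" "2 \<le> r" "e \<in> E"
  obtains vs es where "berge_path V E vs es" "e \<in> set es" "length es = max_berge_length V E e"
proof -
  let ?K = "{k. \<exists>vs es. berge_path V E vs es \<and> length es = k \<and> e \<in> set es}"
  note H = uniform_hypergraphD[OF assms(1)]
  have "card e \<ge> 2" using H(4) assms by auto
  then obtain u v where "u \<in> e" "v \<in> e" "u \<noteq> v"
    by (metis card_2_iff' obtain_subset_with_card_n subset_iff)
  then have "berge_path V E [u, v] [e]"
    using H(3) assms by (intro berge_path_single_edge) auto
  then have "length [e] \<in> ?K" by (metis (mono_tags, lifting) list.set_intros(1) mem_Collect_eq)
  then have "?K \<noteq> {}" by blast
  then have "Max ?K \<in> ?K" by (intro Max_in finite_berge_lengths H)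
  then show ?thesis using that unfolding max_berge_length_def by auto
qed

lemma max_berge_length_pos:
  assumes "uniform_hypergraph r V E" "2 \<le> r" "e \<in> E"
  shows "1 \<le> max_berge_length V E e"
proof -
  obtain vs es where "e \<in> set es" "length es = max_berge_length V E e"
    using max_berge_length_attained[OF assms] by metis
  then show ?thesis by (cases es) auto
qed

section \<open>Values and strict growth of the weight function\<close>

lemma weight_fn_1: "weight_fn r 1 = 1 / real r"
  by (simp add: weight_fn_def)

lemma weight_fn_small:
  assumes "2 \<le> k" "k < r"
  shows "weight_fn r (real k) = real k / (real r + 1)"
proof -
  have "real k + 1 \<le> real r" using assms(2) by linarith
  then show ?thesis using assms by (simp add: weight_fn_def)
qed

lemma weight_fn_large:
  assumes "3 \<le> r" "r \<le> k"
  shows "weight_fn r (real k) = real (k choose (r - 1)) / real r"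
  using assms by (simp add: weight_fn_def binomial_gbinomial)

lemma weight_fn_pos:
  assumes "3 \<le> r" "1 \<le> k"
  shows "0 < weight_fn r (real k)"
proof -
  consider "k = 1" | "2 \<le> k" "k < r" | "r \<le> k" using assms by linarith
  then show ?thesis
    using assms by cases (auto simp: weight_fn_1 weight_fn_small weight_fn_large)
qed

lemma weight_fn_less_Suc:
  assumes "3 \<le> r" "1 \<le> k"
  shows "weight_fn r (real k) < weight_fn r (real (Suc k))"
proof -
  consider "k = 1" | "2 \<le> k" "Suc k < r" | "2 \<le> k" "Suc k = r" | "r \<le> k" using assms by linarith
  then show ?thesis
  proof cases
    case 1
    then have "weight_fn r (real (Suc k)) = 2 / (real r + 1)"
      using weight_fn_small[of 2 r] assms by simp
    moreover have "1 / real r < 2 / (real r + 1)" using assms by (simp add: field_simps)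
    ultimately show ?thesis using 1 by (simp add: weight_fn_1)
  next
    case 2
    then show ?thesis
      unfolding weight_fn_small[of "Suc k" r, OF le_SucI[OF 2(1)] 2(2)]
      by (subst weight_fn_small) (auto simp: divide_strict_right_mono)
  next
    case 3
    \<comment> \<open>The formula changes here: (r - 1)/(r + 1) is followed by (r choose (r - 1))/r
      = 1.\<close>
    then have "weight_fn r (real (Suc k)) = 1"
      using weight_fn_large[of r "Suc k"] assms by (auto simp: binomial_symmetric[of k "Suc k"])
    moreover have "weight_fn r (real k) < 1" using 3 by (subst weight_fn_small) auto
    ultimately show ?thesis by simp
  next
    case 4
    have "k choose (r - 2) > 0" using 4 by simp
    then have "k choose (r - 1) < Suc k choose (r - 1)"
      using assms binomial_Suc_Suc[of k "r - 2"] by (simp add: Suc_diff_le numeral_2_eq_2 Suc_diff_Suc)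
    then show ?thesis
      using 4 assms by (simp add: weight_fn_large divide_strict_right_mono del: of_nat_Suc)
  qed
qed

lemma weight_fn_strict_mono:
  assumes "3 \<le> r" "1 \<le> k" "k < k'"
  shows "weight_fn r (real k) < weight_fn r (real k')"
  using assms(3)
proof (induction k')
  case (Suc k')
  then show ?case
    using weight_fn_less_Suc[of r k'] assms
    by (cases "k = k'") (auto simp del: of_nat_Suc)
qed simp

section \<open>Berge cycles\<close>

text \<open>A cycle is kept as a path with a distinguished closing edge \<open>g\<close>. It has
  \<open>length es + 1\<close> vertices and as many edges, so \<open>length es = k\<close> means k +
  1 vertices and \<open>Suc (length es) = k\<close> means k vertices.\<close>

definition berge_cycle :: "'a set \<Rightarrow> 'a set set \<Rightarrow> 'a list \<Rightarrow> 'a set list \<Rightarrow> 'a set \<Rightarrow> bool" where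
  "berge_cycle V E vs es g \<longleftrightarrow>
     berge_path V E vs es \<and> g \<in> E \<and> g \<notin> set es \<and> hd vs \<in> g \<and> last vs \<in> g"

lemma berge_cycle_path: "berge_cycle V E vs es g \<Longrightarrow> berge_path V E vs es"
  by (simp add: berge_cycle_def)

lemma berge_cycle_rev: "berge_cycle V E vs es g \<Longrightarrow> berge_cycle V E (rev vs) (rev es) g"
  by (auto simp: berge_cycle_def berge_path_rev hd_rev last_rev)

text \<open>A cycle can be cut open at any of its edges: \<open>e\<close> becomes the closing edge,
  and \<open>g\<close> now joins the end of \<open>B\<close> to the start of
  \<open>A\<close>.\<close>

lemma berge_cycle_append:
  assumes "berge_cycle V E (A @ B) (EA @ e # EB) g" "length A = Suc (length EA)" "B \<noteq> []"
  shows "berge_cycle V E (B @ A) (EB @ g # EA) e"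
proof -
  have A: "A \<noteq> []" using assms by auto
  have l: "links A EA \<and> links B EB \<and> last A \<in> e \<and> hd B \<in> e"
    using assms links_append[OF assms(2,3)] by (simp add: berge_cycle_def berge_path_iff_links)
  then have "length B = Suc (length EB)" using links_length by blast
  then have "links (B @ A) (EB @ g # EA)"
    using l A assms by (subst links_append) (auto simp: berge_cycle_def)
  then show ?thesis
    using assms l A by (auto simp: berge_cycle_def berge_path_iff_links)
qed

lemma berge_cycle_rotate_append:
  assumes "berge_cycle V E (A @ B) es g" "A \<noteq> []" "B \<noteq> []"
  obtains es' g' where "berge_cycle V E (B @ A) es' g'"
    "insert g' (set es') = insert g (set es)" "length es' = length es"
proof -
  have "links (A @ B) es" using assms(1) by (simp add: berge_cycle_def berge_path_iff_links)
  then obtain EA e EB where "es = EA @ e # EB" "length A = Suc (length EA)"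
    using links_split_at assms by metis
  then show ?thesis
    using berge_cycle_append[of V E A B EA e EB g] assms that[of "EB @ g # EA" e] by auto
qed

lemma berge_cycle_rotate_vertex:
  assumes "berge_cycle V E vs es g" "v \<in> set vs"
  obtains vs' es' g' where "berge_cycle V E vs' es' g'" "hd vs' = v" "set vs' = set vs"
    "insert g' (set es') = insert g (set es)" "length es' = length es"
proof -
  obtain A B where vs: "vs = A @ v # B" using assms(2) split_list by metis
  show ?thesis
  proof (cases "A = []")
    case True
    then show ?thesis using that assms vs by auto
  next
    case False
    then obtain es' g' where "berge_cycle V E ((v # B) @ A) es' g'"
      "insert g' (set es') = insert g (set es)" "length es' = length es"
      using berge_cycle_rotate_append assms vs by (metis list.distinct(1))
    then show ?thesis using that vs by fastforce
  qed
qed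

lemma berge_cycle_rotate_edge:
  assumes "berge_cycle V E vs es g" "e \<in> insert g (set es)"
  obtains vs' es' where "berge_cycle V E vs' es' e" "set vs' = set vs"
    "insert e (set es') = insert g (set es)" "length es' = length es"
proof (cases "e = g")
  case True
  then show ?thesis using that assms by blast
next
  case False
  then obtain EA EB where es: "es = EA @ e # EB" using assms(2) split_list by fastforce
  have "links vs (EA @ e # EB)"
    using assms(1) es by (simp add: berge_cycle_def berge_path_iff_links)
  then obtain A B where "vs = A @ B" "length A = Suc (length EA)" "B \<noteq> []"
    using links_split_edge by metis
  then show ?thesis
    using berge_cycle_append[of V E A B EA e EB g] assms es that[of "B @ A" "EB @ g # EA"] by auto
qed

lemma berge_cycle_pendant:
  assumes "berge_cycle V E vs es g" "w \<in> g" "w \<in> V" "w \<notin> set vs"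
  shows "berge_path V E (w # vs) (g # es)"
  using assms by (intro berge_path_Cons) (auto simp: berge_cycle_def)

text \<open>Posa rotation: \<open>f\<close> joins the first vertex to \<open>hd B\<close>, the
  segment \<open>A\<close> is reversed, and \<open>last A\<close> becomes the new first vertex. The
  case \<open>f = e\<close> is allowed.\<close>

lemma berge_path_rotate:
  assumes "berge_path V E (A @ B) (EA @ e # EB)" "length A = Suc (length EA)" "B \<noteq> []"
    "f \<in> E" "f \<notin> set EA" "f \<notin> set EB" "hd A \<in> f" "hd B \<in> f"
  shows "berge_path V E (rev A @ B) (rev EA @ f # EB)"
proof -
  have A: "A \<noteq> []" using assms by auto
  have l: "links A EA \<and> links B EB"
    using assms links_append[OF assms(2,3)] by (simp add: berge_path_iff_links)
  then have "links (rev A @ B) (rev EA @ f # EB)"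
    using A assms by (subst links_append) (auto simp: last_rev)
  then show ?thesis using assms by (auto simp: berge_path_iff_links)
qed

text \<open>The length is tied to the individual edge, not to one global maximum, so that the
  property survives when two separate parts with different longest paths are put together.\<close>

definition all_ends :: "'a set \<Rightarrow> 'a set set \<Rightarrow> bool" where
  "all_ends V E \<longleftrightarrow> (\<forall>w\<in>V. \<exists>e\<in>E. \<exists>vs es. berge_path V E vs es \<and> hd vs = w \<and>
     e \<in> set es \<and> length es = max_berge_length V E e)"

definition extremal :: "nat \<Rightarrow> 'a set \<Rightarrow> 'a set set \<Rightarrow> bool" where
  "extremal r V E \<longleftrightarrow> (card V = r + 1 \<and> card E \<in> {1..r - 1} \<union> {r + 1}) \<or>
     (card V \<noteq> r + 1 \<and> E = complete_uniform_edges r V)"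

section \<open>Reducing sets, and cycles with k + 1 vertices\<close>

locale max_berge =
  fixes r k :: nat and V :: "'a set" and E :: "'a set set"
  assumes r3: "3 \<le> r" and unif: "uniform_hypergraph r V E" and k1: "1 \<le> k"
    and bound: "\<And>vs es. berge_path V E vs es \<Longrightarrow> length es \<le> k"
begin

abbreviation "path \<equiv> berge_path V E"
abbreviation "cycle \<equiv> berge_cycle V E"
abbreviation "p \<equiv> max_berge_length V E"

definition incident :: "'a set \<Rightarrow> 'a set set" where
  "incident S = {e \<in> E. e \<inter> S \<noteq> {}}"

lemmas finV = uniform_hypergraphD(1)[OF unif]
  and finE = uniform_hypergraphD(2)[OF unif]
  and sub = uniform_hypergraphD(3)[OF unif]
  and card_edge = uniform_hypergraphD(4)[OF unif]
  and fin_edge = uniform_hypergraphD(5)[OF unif]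

lemma p_eqI:
  assumes "path vs es" "length es = k" "e \<in> set es"
  shows "p e = k"
proof -
  have "e \<in> E" using assms by (auto simp: berge_path_def)
  then obtain vs' es' where "path vs' es'" "length es' = p e"
    using max_berge_length_attained[OF unif _ \<open>e \<in> E\<close>] r3 by (metis One_nat_def Suc_leD numeral_2_eq_2 numeral_3_eq_3)
  then have "p e \<le> k" using bound by metis
  moreover have "k \<le> p e" using max_berge_length_ge[OF finV assms(1,3)] assms(2) by simp
  ultimately show ?thesis by simp
qed

text \<open>A vertex of \<open>e\<close> outside the path could be put in front of it, giving length
  k + 1.\<close>

lemma end_edge_subset:
  assumes "path vs es" "length es = k" "e \<in> E" "e \<notin> set es" "hd vs \<in> e"
  shows "e \<subseteq> set vs"
proof
  fix u assume "u \<in> e"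
  show "u \<in> set vs"
  proof (rule ccontr)
    assume "u \<notin> set vs"
    then have "path (u # vs) (e # es)"
      using assms sub \<open>u \<in> e\<close> by (intro berge_path_Cons) auto
    then show False using bound assms(2) by fastforce
  qed
qed

text \<open>If \<open>e\<close> is not yet a defining edge, it contains a second path vertex
  \<open>u\<close>; rotating with \<open>e\<close> as the chord to \<open>u\<close> gives a path of
  the same length through \<open>e\<close>.\<close>

lemma p_end_edge:
  assumes "path vs es" "length es = k" "e \<in> E" "hd vs \<in> e"
  shows "p e = k"
proof (cases "e \<in> set es")
  case True
  then show ?thesis using p_eqI assms by blast
next
  case False
  then have "e \<subseteq> set vs" using end_edge_subset assms by blast
  have "\<not> e \<subseteq> {hd vs}"
    using card_mono[of "{hd vs}" e] card_edge[OF assms(3)] r3 by auto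
  then obtain u where u: "u \<in> e" "u \<noteq> hd vs" by blast
  then obtain A B where vs: "vs = A @ u # B" "A \<noteq> []"
    using \<open>e \<subseteq> set vs\<close> by (metis append_Nil in_mono list.sel(1) split_list)
  have "links (A @ u # B) es" using assms vs by (simp add: berge_path_iff_links)
  then obtain EA f EB where es: "es = EA @ f # EB" "length A = Suc (length EA)"
    using links_split_at vs(2) by (metis list.distinct(1))
  have "path (rev A @ u # B) (rev EA @ e # EB)"
    using assms u False by (intro berge_path_rotate[where e = f]) (auto simp: vs es)
  then show ?thesis
    by (rule p_eqI) (use assms(2) in \<open>simp_all add: es\<close>)
qed

text \<open>Since \<open>p e = k\<close> for the edges concerned, the last condition says that their
  total weight is at most \<open>card S\<close>.\<close>

definition good :: "'a set \<Rightarrow> bool" where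
  "good S \<longleftrightarrow> S \<subseteq> V \<and> S \<noteq> {} \<and> (\<forall>e\<in>incident S. p e = k) \<and>
     real (card (incident S)) \<le> weight_fn r k * real (card S)"

text \<open>Proper sets \<open>S\<close> owe nothing in the case of equality; the induction or
  connectedness handles them later.\<close>

definition settled :: "'a set \<Rightarrow> bool" where
  "settled S \<longleftrightarrow> good S \<and>
     (S = V \<and> real (card (incident S)) = weight_fn r k * real (card S) \<longrightarrow> all_ends V E \<and> extremal r V E)"

lemma long_cycle_end:
  assumes "cycle vs es g" "length es = k" "v \<in> set vs"
  obtains vs' es' where "path vs' es'" "length es' = k" "hd vs' = v" "set vs' = set vs"
    "set es' \<subseteq> insert g (set es)"
  using berge_cycle_rotate_vertex[OF assms(1,3)] assms(2) berge_cycle_path by (metis subset_insertI)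

lemma p_long_cycle:
  assumes "cycle vs es g" "length es = k" "e \<in> E" "e \<inter> set vs \<noteq> {}"
  shows "p e = k"
proof -
  obtain v where "v \<in> e" "v \<in> set vs" using assms(4) by blast
  then show ?thesis using long_cycle_end[OF assms(1,2)] p_end_edge assms(3) by metis
qed

text \<open>The cycle can be opened so that \<open>e\<close> is outside the resulting path of length
  k but contains its first vertex: at \<open>e\<close> itself if \<open>e\<close> is a cycle edge,
  otherwise next to a vertex of \<open>e\<close>.\<close>

lemma long_cycle_edge_subset:
  assumes "cycle vs es g" "length es = k" "e \<in> E" "e \<inter> set vs \<noteq> {}"
  shows "e \<subseteq> set vs"
proof (cases "e \<in> insert g (set es)")
  case True
  then obtain vs' es' where *: "cycle vs' es' e" "set vs' = set vs" "length es' = length es"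
    using berge_cycle_rotate_edge[OF assms(1)] by metis
  then have "e \<subseteq> set vs'"
    using assms by (intro end_edge_subset) (auto simp: berge_cycle_def)
  then show ?thesis using * by simp
next
  case False
  obtain v where v: "v \<in> e" "v \<in> set vs" using assms(4) by blast
  then obtain vs' es' where "path vs' es'" "length es' = k" "hd vs' = v" "set vs' = set vs"
    "set es' \<subseteq> insert g (set es)"
    using long_cycle_end[OF assms(1,2)] by metis
  then show ?thesis using end_edge_subset[of vs' es' e] False v assms(3) by blast
qed

lemma settled_long_cycle:
  assumes "cycle vs es g" "length es = k" "r \<le> k"
  shows "settled (set vs)"
proof -
  let ?S = "set vs"
  have S: "?S \<subseteq> V" "?S \<noteq> {}" "card ?S = k + 1"
    using assms(1,2) berge_path_not_Nil by (auto simp: berge_cycle_def berge_path_def distinct_card)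
  have fin: "finite {e. e \<subseteq> ?S \<and> card e = r}" by simp
  have inc: "incident ?S \<subseteq> {e. e \<subseteq> ?S \<and> card e = r}"
    using long_cycle_edge_subset[OF assms(1,2)] card_edge by (auto simp: incident_def)
  have card_all: "card {e. e \<subseteq> ?S \<and> card e = r} = (k + 1) choose r"
    using n_subsets[of ?S r] S(3) by simp
  \<comment> \<open>This identity makes f(k) times the k + 1 cycle vertices exactly the number of
    possible edges, so equality forces the complete hypergraph.\<close>
  have "r * ((k + 1) choose r) = (k + 1) * (k choose (r - 1))"
    using r3 Suc_times_binomial_eq[of k "r - 1"] by (simp add: mult.commute)
  then have "real r * real ((k + 1) choose r) = real (k + 1) * real (k choose (r - 1))"
    by (metis of_nat_mult)
  then have w: "weight_fn r k * real (card ?S) = real ((k + 1) choose r)"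
    using S r3 assms(3) by (simp add: weight_fn_large field_simps)
  have le: "card (incident ?S) \<le> (k + 1) choose r"
    using card_mono[OF fin inc] card_all by simp
  have good: "good ?S"
    unfolding good_def using S le w p_long_cycle[OF assms(1,2)] by (auto simp: incident_def)
  have "all_ends V E \<and> extremal r V E"
    if "?S = V" "real (card (incident ?S)) = weight_fn r k * real (card ?S)"
  proof
    have "e \<noteq> {}" if "e \<in> E" for e using card_edge[OF that] r3 by auto
    then have E: "incident ?S = E" using sub \<open>?S = V\<close> by (fastforce simp: incident_def)
    have "card E = (k + 1) choose r" using that w E by simp
    moreover from this have "E = complete_uniform_edges r V"
      using card_subset_eq[OF fin inc] card_all E \<open>?S = V\<close> by (simp add: complete_uniform_edges_def)
    moreover have "card V = k + 1" using S \<open>?S = V\<close> by simp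
    ultimately show "extremal r V E" unfolding extremal_def using r3 by auto
    show "all_ends V E" unfolding all_ends_def
    proof
      fix w assume "w \<in> V"
      then obtain vs' es' where *: "path vs' es'" "length es' = k" "hd vs' = w"
        using long_cycle_end[OF assms(1,2)] \<open>?S = V\<close> by metis
      then have "hd es' \<in> set es'" using k1 by (cases es') auto
      then show "\<exists>e\<in>E. \<exists>vs es. path vs es \<and> hd vs = w \<and> e \<in> set es \<and> length es = p e"
        using * p_eqI[OF *(1,2)] by (metis berge_path_def subsetD)
    qed
  qed
  then show ?thesis using good by (auto simp: settled_def)
qed

end

section \<open>Longest paths with at most r edges\<close>

context max_berge
begin

lemma settled_proper: "good S \<Longrightarrow> S \<noteq> V \<Longrightarrow> settled S"
  by (simp add: settled_def)

lemma goodI: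
  assumes "S \<subseteq> V" "S \<noteq> {}"
    and "\<And>v. v \<in> S \<Longrightarrow> \<exists>vs es. path vs es \<and> length es = k \<and> hd vs = v"
    and "real (card (incident S)) \<le> weight_fn r k * real (card S)"
  shows "good S"
  unfolding good_def
proof (intro conjI ballI)
  fix e assume "e \<in> incident S"
  then obtain v where "e \<in> E" "v \<in> e" "v \<in> S" by (auto simp: incident_def)
  then show "p e = k" using assms(3) p_end_edge by metis
qed (use assms in auto)

lemma all_endsI:
  assumes "\<And>w. w \<in> V \<Longrightarrow> \<exists>vs es. path vs es \<and> length es = k \<and> hd vs = w"
  shows "all_ends V E"
  unfolding all_ends_def
proof
  fix w assume "w \<in> V"
  then obtain vs es where *: "path vs es" "length es = k" "hd vs = w" using assms by metis
  then have "hd es \<in> set es" using k1 by (cases es) auto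
  then show "\<exists>e\<in>E. \<exists>vs es. path vs es \<and> hd vs = w \<and> e \<in> set es \<and> length es = p e"
    using * p_eqI[OF *(1,2)] by (metis berge_path_def subsetD)
qed

lemma edge_not_empty: "e \<in> E \<Longrightarrow> e \<noteq> {}"
  using card_edge r3 by fastforce

lemma incident_V: "incident V = E"
  using sub edge_not_empty by (fastforce simp: incident_def)

lemma edge_eqI: "e \<in> E \<Longrightarrow> finite A \<Longrightarrow> card A \<le> r \<Longrightarrow> e \<subseteq> A \<Longrightarrow> e = A"
  using card_edge by (metis card_seteq)

text \<open>Two distinct edges that meet would give a path of length 2. Hence edges are pairwise
  disjoint, and f(1) = 1/r balances one edge against its own r vertices.\<close>

lemma settled_single:
  assumes "k = 1" "path vs es" "length es = k"
  shows "\<exists>S. settled S"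
proof -
  obtain e where e: "e \<in> E" "path vs [e]"
    using assms by (cases es) (auto simp: berge_path_def)
  have "f = e" if f: "f \<in> E" "f \<inter> e \<noteq> {}" for f
  proof (rule ccontr)
    assume "f \<noteq> e"
    then have "\<not> e \<subseteq> f" using edge_eqI[OF e(1) fin_edge[OF f(1)]] card_edge[OF f(1)] by auto
    then obtain u where u: "u \<in> e" "u \<notin> f" by blast
    obtain w where w: "w \<in> f" "w \<in> e" using f by blast
    have "\<not> f \<subseteq> {w}" using card_mono[of "{w}" f] card_edge[OF f(1)] r3 by auto
    then obtain x where "x \<in> f" "x \<noteq> w" by blast
    then have "path [u, w, x] [e, f]"
      using u w e(1) f(1) \<open>f \<noteq> e\<close> sub by (auto simp: berge_path_iff_links)
    then show False using bound assms(1) by fastforce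
  qed
  then have inc: "incident e = {e}" using e(1) edge_not_empty by (auto simp: incident_def)
  have ends: "\<exists>vs es. path vs es \<and> length es = k \<and> hd vs = w" if "w \<in> e" for w
  proof -
    have "\<not> e \<subseteq> {w}" using card_mono[of "{w}" e] card_edge[OF e(1)] r3 by auto
    then obtain x where "x \<in> e" "x \<noteq> w" by blast
    then have "path [w, x] [e]"
      using berge_path_single_edge[of e E V w x] e(1) sub that by auto
    then show ?thesis using assms(1) by fastforce
  qed
  have "good e"
    using e(1) sub edge_not_empty r3 assms(1) ends
    by (intro goodI) (auto simp: inc card_edge weight_fn_1)
  moreover have "all_ends V E \<and> extremal r V E" if "e = V"
  proof
    show "all_ends V E" using all_endsI ends that by blast
    have "E = {V}" using incident_V inc that by simp
    moreover have "card V = r" using that card_edge e(1) by blast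
    moreover have "{e. e \<subseteq> V \<and> card e = card V} = {V}" using card_subset_eq[OF finV] by blast
    ultimately show "extremal r V E" by (simp add: extremal_def complete_uniform_edges_def)
  qed
  ultimately show ?thesis by (auto simp: settled_def)
qed

text \<open>All edges of such a cycle lie in its k + 1 vertices. As k + 1 is at most r, each of them
  equals the vertex set, although \<open>g\<close> and the first path edge are distinct.\<close>

lemma no_long_cycle_small:
  assumes "k < r" "cycle vs es g" "length es = k"
  shows False
proof -
  have *: "path vs es" "g \<in> E" "g \<notin> set es" "hd vs \<in> g"
    using assms(2) by (auto simp: berge_cycle_def)
  have card: "card (set vs) \<le> r"
    using * assms by (simp add: berge_path_def distinct_card)
  have hd: "hd vs \<in> set vs" using berge_path_not_Nil *(1) by (metis hd_in_set)
  then have "g \<subseteq> set vs"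
    using *(4) by (intro long_cycle_edge_subset[OF assms(2,3) *(2)]) blast
  then have "g = set vs" using *(2) card by (intro edge_eqI) auto
  obtain e es' where es: "es = e # es'" using assms k1 by (cases es) auto
  have "links vs (e # es')" "e \<in> E" using *(1) es by (auto simp: berge_path_iff_links)
  then have "hd vs \<in> e" by (cases "(vs, e # es')" rule: links.cases) auto
  then have "e \<subseteq> set vs"
    using hd by (intro long_cycle_edge_subset[OF assms(2,3) \<open>e \<in> E\<close>]) blast
  then have "e = set vs" using \<open>e \<in> E\<close> card by (intro edge_eqI) auto
  then show False using \<open>g = set vs\<close> *(3) es by simp
qed

lemma weight_r: "k = r \<Longrightarrow> weight_fn r k = 1"
  using weight_fn_large[of r r] binomial_symmetric[of 1 r] r3 by simp

lemma weight_ge_small: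
  assumes "2 \<le> k" "k \<le> r"
  shows "real k / (real r + 1) \<le> weight_fn r k"
  using assms weight_r by (cases "k = r") (auto simp: weight_fn_small)

end

section \<open>No cycle with k + 1 vertices, and k at most r\<close>

locale max_berge_no_long = max_berge +
  assumes no_long: "\<And>vs es g. cycle vs es g \<Longrightarrow> length es \<noteq> k"
begin

text \<open>An outside edge \<open>e\<close> at the first vertex stays in the path and avoids its
  last vertex, as no cycle has k + 1 vertices; since k is at most r, \<open>e\<close> is the whole
  path without the last vertex. Then \<open>e\<close> can replace the first path edge, which becomes
  an outside edge itself and must equal the same set.\<close>

lemma end_edge_in_path:
  assumes "2 \<le> k" "k \<le> r" "path vs es" "length es = k" "e \<in> E" "hd vs \<in> e"
  shows "e \<in> set es"
proof (rule ccontr)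
  assume "e \<notin> set es"
  have len: "length vs = Suc k" using assms berge_path_length by metis
  obtain v0 v1 B where vs: "vs = v0 # v1 # B" "B \<noteq> []"
    using len assms(1) by (cases vs; cases "tl vs"; cases "tl (tl vs)") auto
  obtain e1 EB where es: "es = e1 # EB" using assms by (cases es) auto
  have card: "card (set vs) = Suc k" using assms(3) len by (simp add: berge_path_def distinct_card)
  have not_last: "f = set vs - {last vs}"
    if "path vs fs" "length fs = k" "f \<in> E" "f \<notin> set fs" "hd vs \<in> f" for f fs
  proof -
    have "last vs \<notin> f"
      using that no_long[of vs fs f] by (auto simp: berge_cycle_def)
    moreover have "f \<subseteq> set vs" using end_edge_subset that by blast
    moreover have "last vs \<in> set vs" using vs by simp
    ultimately show ?thesis
      using that card assms(2) by (intro edge_eqI) auto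
  qed
  have e: "e = set vs - {last vs}" using not_last assms \<open>e \<notin> set es\<close> by blast
  have "distinct vs" using assms(3) by (simp add: berge_path_def)
  then have "v1 \<in> e" "v0 \<in> e1" using vs es assms(3) e by (auto simp: berge_path_iff_links)
  then have "path vs (e # EB)"
    using assms vs es \<open>e \<notin> set es\<close> by (auto simp: berge_path_iff_links)
  moreover have "e1 \<notin> set (e # EB)" "e1 \<in> E"
    using assms(3) \<open>e \<notin> set es\<close> es by (auto simp: berge_path_def)
  ultimately have "e1 = set vs - {last vs}"
    using not_last[of "e # EB" e1] assms(4) es vs \<open>v0 \<in> e1\<close> by simp
  then show False using e \<open>e \<notin> set es\<close> es by simp
qed

lemma settled_short_cycle:
  assumes "2 \<le> k" "k \<le> r" "cycle vs es g" "Suc (length es) = k"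
  shows "settled (\<Union> (insert g (set es)))"
proof -
  let ?F = "insert g (set es)"
  let ?U = "\<Union> ?F"
  have F: "?F \<subseteq> E" "card ?F = k"
    using assms by (auto simp: berge_cycle_def berge_path_def distinct_card)
  have card_vs: "card (set vs) = k"
    using assms(3,4) by (simp add: berge_cycle_def berge_path_def distinct_card)
  \<comment> \<open>A cycle edge \<open>g'\<close> leaving the cycle gives a path of length k once
    it is the closing edge: from an outer vertex of \<open>g'\<close> into the cycle, or from the
    head around the cycle and out through \<open>g'\<close>.\<close>
  have exit: "\<exists>fs ws. path ws fs \<and> length fs = k \<and> hd ws = w \<and> set fs = ?F"
    if cyc: "cycle vs' es' g'" "set vs' = set vs" "insert g' (set es') = ?F" "length es' = length es"
      and w: "w \<in> g' - set vs \<or> (w = hd vs' \<and> \<not> g' \<subseteq> set vs)" for vs' es' g' w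
  proof -
    have ext: "path (u # us) (g' # fs)" "length (g' # fs) = k" "set (g' # fs) = ?F"
      if "u \<in> g' - set vs" "cycle us fs g'" "set us = set vs'" "set fs = set es'" "length fs = length es'"
      for u us fs
    proof -
      have "g' \<in> E" using that(2) by (simp add: berge_cycle_def)
      then show "path (u # us) (g' # fs)"
        using that cyc sub[of g'] by (intro berge_cycle_pendant) auto
    qed (use that cyc assms in auto)
    show ?thesis
    proof (cases "w \<in> g' - set vs")
      case True
      then show ?thesis using ext[of w vs' es'] cyc(1) by fastforce
    next
      case False
      then obtain u where u: "u \<in> g' - set vs" "w = hd vs'" using w by blast
      have "vs' \<noteq> []" using cyc(1) berge_cycle_path berge_path_not_Nil by metis
      have "path (u # rev vs') (g' # rev es')" "length (g' # rev es') = k" "set (g' # rev es') = ?F"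
        using ext[OF u(1) berge_cycle_rev[OF cyc(1)]] by simp_all
      then have "path (vs' @ [u]) (es' @ [g'])" "length (es' @ [g']) = k" "set (es' @ [g']) = ?F"
        using berge_path_rev by fastforce+
      then show ?thesis using u(2) \<open>vs' \<noteq> []\<close> by (metis hd_append2)
    qed
  qed
  have ends: "\<exists>fs ws. path ws fs \<and> length fs = k \<and> hd ws = w \<and> set fs = ?F" if w: "w \<in> ?U" for w
  proof (cases "w \<in> set vs")
    case False
    then obtain f where f: "f \<in> ?F" "w \<in> f" using w by blast
    then show ?thesis
      using berge_cycle_rotate_edge[OF assms(3) f(1)] exit False by (metis DiffI)
  next
    case True
    then obtain vs' es' g' where cyc: "cycle vs' es' g'" "hd vs' = w" "set vs' = set vs"
      "insert g' (set es') = ?F" "length es' = length es"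
      using berge_cycle_rotate_vertex[OF assms(3)] by metis
    show ?thesis
    proof (cases "g' \<subseteq> set vs")
      case False
      then show ?thesis using exit cyc by metis
    next
      case True
      have g': "g' \<in> E" "g' \<notin> set es'" "path vs' es'" using cyc(1) by (auto simp: berge_cycle_def)
      then have g'_eq: "g' = set vs" using True card_vs assms(2) by (intro edge_eqI) auto
      \<comment> \<open>The vertex \<open>w\<close> lies on two cycle edges, \<open>g'\<close> and
        \<open>e1\<close>. As \<open>g'\<close> is the vertex set itself, \<open>e1\<close> is
        different and must leave the cycle; so the cycle is traversed backwards with
        \<open>e1\<close> as closing edge.\<close>
      obtain e1 EB where es': "es' = e1 # EB" using cyc(5) assms(1,4) by (cases es') auto
      obtain B where vs': "vs' = w # B" "B \<noteq> []"
        using cyc(2) berge_path_length[OF g'(3)] es' by (cases vs'; cases "tl vs'") auto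
      have "cycle ([w] @ B) ([] @ e1 # EB) g'" using cyc(1) vs' es' by simp
      then have "cycle (B @ [w]) (EB @ [g']) e1"
        using berge_cycle_append[of V E "[w]" B "[]" e1 EB g'] vs'(2) by simp
      then have c: "cycle (w # rev B) (g' # rev EB) e1"
        using berge_cycle_rev by fastforce
      have "e1 \<in> E" using c by (simp add: berge_cycle_def)
      then have "\<not> e1 \<subseteq> set vs"
        using edge_eqI[of e1 "set vs"] card_vs assms(2) g' g'_eq es' by auto
      moreover have "set (w # rev B) = set vs" "length (g' # rev EB) = length es"
        using cyc(3,5) vs'(1) es' by auto
      moreover have "insert e1 (set (g' # rev EB)) = ?F"
        using cyc(4) es' by (simp add: insert_commute)
      ultimately show ?thesis using exit[OF c] by auto
    qed
  qed
  have "incident ?U \<subseteq> ?F"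
  proof
    fix e assume "e \<in> incident ?U"
    then obtain w where "e \<in> E" "w \<in> e" "w \<in> ?U" unfolding incident_def by blast
    then show "e \<in> ?F" using ends[of w] end_edge_in_path[OF assms(1,2)] by metis
  qed
  moreover have "?F \<subseteq> incident ?U" using F(1) edge_not_empty by (auto simp: incident_def)
  ultimately have inc: "incident ?U = ?F" by (rule subset_antisym)
  have U: "?U \<subseteq> V" using F(1) sub by blast
  then have "finite ?U" using finV finite_subset by blast
  obtain e1 EB where es: "es = e1 # EB" using assms(1,4) by (cases es) auto
  have "r + 1 \<le> card ?U"
  proof (rule ccontr)
    assume "\<not> r + 1 \<le> card ?U"
    then have "f = ?U" if "f \<in> ?F" for f
      using F(1) that \<open>finite ?U\<close> by (intro edge_eqI) auto
    moreover have "e1 \<in> ?F" using es by simp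
    ultimately have "g = e1" by blast
    then show False using assms(3) es by (auto simp: berge_cycle_def)
  qed
  have bnd: "real (card (incident ?U)) \<le> weight_fn r k * real (card ?U)"
  proof -
    have "real k = real k / (real r + 1) * real (r + 1)" by (simp add: field_simps)
    also have "\<dots> \<le> weight_fn r k * real (card ?U)"
      using weight_ge_small[OF assms(1,2)] \<open>r + 1 \<le> card ?U\<close> k1 r3 weight_fn_pos[OF r3 k1]
      by (intro mult_mono) auto
    finally show ?thesis using inc F(2) by simp
  qed
  have "good ?U"
  proof (rule goodI[OF U _ _ bnd])
    have "g \<noteq> {}" using F(1) edge_not_empty by blast
    then show "?U \<noteq> {}" by blast
  qed (use ends in metis)
  moreover have "all_ends V E \<and> extremal r V E"
    if "?U = V" "real (card (incident ?U)) = weight_fn r k * real (card ?U)"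
  proof
    show "all_ends V E" using ends \<open>?U = V\<close> by (intro all_endsI) metis
    have E: "card E = k" using incident_V inc F(2) \<open>?U = V\<close> by simp
    \<comment> \<open>For k = r the weight is 1, and equality would give only r vertices.\<close>
    have "k \<noteq> r" using that inc F(2) weight_r \<open>r + 1 \<le> card ?U\<close> by auto
    then have "k < r" using assms(2) by simp
    then have "real k * real (r + 1) = real k * real (card V)"
      using that(2) inc F(2) assms(1) unfolding \<open>?U = V\<close> by (simp add: weight_fn_small field_simps)
    then have "card V = r + 1" using k1 by (simp only: mult_cancel_left of_nat_eq_iff) auto
    then show "extremal r V E" using E k1 \<open>k < r\<close> by (simp add: extremal_def)
  qed
  ultimately show ?thesis by (auto simp: settled_def)
qed

text \<open>Here the cycle has k - 1 vertices. Its edges and \<open>h\<close> are k edges that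
  include every edge at an outer vertex of \<open>h\<close>, and the cycle edges adjacent to a
  vertex of \<open>h\<close> miss these outer vertices altogether.\<close>

lemma settled_lollipop:
  assumes "3 \<le> k" "k \<le> r" and no_short: "\<nexists>vs es g. cycle vs es g \<and> Suc (length es) = k"
    and cyc: "cycle C EC g" "Suc (Suc (length EC)) = k"
    and h: "h \<in> E" "h \<notin> insert g (set EC)" "h \<inter> set C \<noteq> {}"
  shows "settled (h - set C)"
proof -
  let ?F = "insert h (insert g (set EC))" and ?S = "h - set C" and ?t = "card (h \<inter> set C)"
  have card_C: "card (set C) = k - 1"
    using cyc by (simp add: berge_cycle_def berge_path_def distinct_card)
  have fin_h: "finite h" using fin_edge h(1) .
  have F: "?F \<subseteq> E" "card ?F = k"
    using cyc h by (auto simp: berge_cycle_def berge_path_def distinct_card)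
  have card_S: "card ?S = r - ?t"
    using card_Diff_subset_Int[of h "set C"] card_edge[OF h(1)] fin_h by simp
  have t: "?t \<le> k - 1" using card_C card_mono[of "set C" "h \<inter> set C"] by simp
  have S_pos: "card ?S \<ge> 1" using card_S t assms(1,2) by simp
  then have S_ne: "?S \<noteq> {}" by force
  have S_V: "?S \<subseteq> V" "?S \<noteq> V" using sub[OF h(1)] h(3) by auto
  \<comment> \<open>A common vertex outside C of h and a cycle edge next to h would give a cycle of length k.\<close>
  have avoid: "x \<notin> g'"
    if c: "cycle C' E' g'" "set C' = set C" "insert g' (set E') = insert g (set EC)" "length E' = length EC"
      and l: "hd C' \<in> h \<or> last C' \<in> h" and x: "x \<in> ?S" for C' E' g' x
  proof
    assume "x \<in> g'"
    have key: False
      if "cycle C'' E'' g'" "set C'' = set C'" "set E'' = set E'" "length E'' = length E'" "hd C'' \<in> h"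
      for C'' E''
    proof -
      have hg: "h \<notin> set E''" "h \<noteq> g'" using c(3) h(2) that(3) by auto
      have "C'' \<noteq> []" using that(1) berge_cycle_path berge_path_not_Nil by metis
      moreover have "path (x # C'') (h # E'')"
        using that x hg sub[OF h(1)] h(1) c(2) by (intro berge_path_Cons) (auto simp: berge_cycle_def)
      ultimately have "cycle (x # C'') (h # E'') g'"
        using that hg \<open>x \<in> g'\<close> by (auto simp: berge_cycle_def)
      then show False using no_short cyc(2) c(4) that(4) by fastforce
    qed
    have "C' \<noteq> []" using c(1) berge_cycle_path berge_path_not_Nil by metis
    then show False
      using l key[of C' E'] key[of "rev C'" "rev E'"] c(1) berge_cycle_rev[OF c(1)]
      by (auto simp: hd_rev)
  qed
  have ends: "\<exists>vs es. path vs es \<and> length es = k \<and> hd vs = x \<and> set es = ?F" if x: "x \<in> ?S" for x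
  proof -
    obtain c where "c \<in> h" "c \<in> set C" using h(3) by blast
    then obtain C' E' g' where c: "cycle C' E' g'" "hd C' = c" "set C' = set C"
      "insert g' (set E') = insert g (set EC)" "length E' = length EC"
      using berge_cycle_rotate_vertex[OF cyc(1)] by metis
    have c': "g' \<in> E" "g' \<notin> set E'" "last C' \<in> g'" "path C' E'" "C' \<noteq> []"
      using c(1) berge_path_not_Nil by (auto simp: berge_cycle_def)
    have "x \<notin> g'" using avoid[OF c(1,3,4,5)] c(2) \<open>c \<in> h\<close> x by blast
    \<comment> \<open>The edge \<open>g'\<close> is too big for the k - 1 cycle vertices. Its outer
      vertex \<open>y\<close> differs from \<open>x\<close>, so the path enters by \<open>h\<close>,
      runs around \<open>C\<close> and leaves by \<open>g'\<close>.\<close>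
    have "\<not> g' \<subseteq> set C"
      using card_mono[of "set C" g'] card_edge[OF c'(1)] card_C assms(1,2) by auto
    then obtain y where y: "y \<in> g'" "y \<notin> set C" by blast
    have hg: "h \<notin> set E'" "h \<noteq> g'" using c(4) h(2) by auto
    have "path (x # C') (h # E')"
      using x c' c \<open>c \<in> h\<close> hg sub[OF h(1)] h(1) by (intro berge_path_Cons) auto
    from berge_path_rev[OF this] have "path (y # rev (x # C')) (g' # rev (h # E'))"
      using y x c' c hg \<open>x \<notin> g'\<close> sub[OF c'(1)]
      by (intro berge_path_Cons) (auto simp: hd_append hd_rev)
    from berge_path_rev[OF this] have "path (x # C' @ [y]) (h # E' @ [g'])" by simp
    moreover have "set (h # E' @ [g']) = ?F" using c(4) by auto
    moreover have "length (h # E' @ [g']) = k" using c(5) cyc(2) by simp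
    ultimately show ?thesis by (metis list.sel(1))
  qed
  have inc: "incident ?S \<subseteq> ?F"
  proof
    fix e assume "e \<in> incident ?S"
    then obtain x where "e \<in> E" "x \<in> e" "x \<in> ?S" unfolding incident_def by blast
    then show "e \<in> ?F" using ends[of x] end_edge_in_path[of _ _ e] assms(1,2)
      by (metis Suc_leD numeral_2_eq_2 numeral_3_eq_3)
  qed
  have "real (card (incident ?S)) \<le> weight_fn r k * real (card ?S)"
  proof (cases "set C \<subseteq> h")
    case True
    \<comment> \<open>Every cycle edge is now adjacent to a vertex of \<open>h\<close> and therefore
      avoids \<open>?S\<close>.\<close>
    have "incident ?S \<subseteq> {h}"
    proof
      fix e assume e: "e \<in> incident ?S"
      show "e \<in> {h}"
      proof (rule ccontr)
        assume "e \<notin> {h}"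
        then have "e \<in> insert g (set EC)" using e inc by blast
        then obtain C' E' where c: "cycle C' E' e" "set C' = set C"
          "insert e (set E') = insert g (set EC)" "length E' = length EC"
          using berge_cycle_rotate_edge[OF cyc(1)] by metis
        have "hd C' \<in> h"
          using True c(1,2) berge_cycle_path berge_path_not_Nil by (metis hd_in_set subsetD)
        then show False using avoid[OF c] e by (auto simp: incident_def)
      qed
    qed
    then have "card (incident ?S) \<le> 1" using card_mono[of "{h}"] by fastforce
    have "h \<inter> set C = set C" using True by blast
    then have S: "card ?S = r + 1 - k" using card_S card_C k1 by simp
    have "1 \<le> weight_fn r k * real (card ?S)"
    proof (cases "k = r")
      case True
      then show ?thesis using weight_r S by simp
    next
      case False
      then have "k < r" using assms(2) by simp
      then obtain d where r: "r = k + 1 + d" using less_imp_Suc_add by fastforce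
      have "k + d + 2 \<le> k * (d + 2)"
        using mult_le_mono1[of 3 k "d + 1"] assms(1) by (simp add: algebra_simps)
      then have "real r + 1 \<le> real k * real (card ?S)"
        using S unfolding r by (simp flip: of_nat_mult of_nat_add of_nat_Suc)
      then show ?thesis
        using \<open>k < r\<close> assms(1) by (simp add: weight_fn_small field_simps)
    qed
    then show ?thesis using \<open>card (incident ?S) \<le> 1\<close> by linarith
  next
    case False
    then obtain b where b: "b \<in> set C" "b \<notin> h" by blast
    then obtain C1 E1 g1 where c1: "cycle C1 E1 g1" "hd C1 = b" "set C1 = set C"
      "insert g1 (set E1) = insert g (set EC)" "length E1 = length EC"
      using berge_cycle_rotate_vertex[OF cyc(1)] by metis
    \<comment> \<open>The cycle is rotated to begin in \<open>h\<close> and to end outside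
      \<open>h\<close>. Then each of the \<open>?t\<close> cycle vertices in \<open>h\<close> is
      followed by its own edge of \<open>E'\<close>, and the closing edge precedes the first of
      them: at least \<open>?t + 1\<close> cycle edges avoid \<open>?S\<close>.\<close>
    let ?P = "takeWhile (\<lambda>v. v \<notin> h) C1" and ?Q = "dropWhile (\<lambda>v. v \<notin> h) C1"
    have "C1 \<noteq> []" using c1(1) berge_cycle_path berge_path_not_Nil by metis
    then have "?P \<noteq> []" using c1(2) b by (cases C1) auto
    then have lastP: "last ?P \<notin> h" by (metis last_in_set set_takeWhileD)
    have "?Q \<noteq> []" using h(3) c1(3) by (auto simp: dropWhile_eq_Nil_conv)
    then have hdQ: "hd ?Q \<in> h" using hd_dropWhile by blast
    have "cycle (?P @ ?Q) E1 g1" using c1(1) by simp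
    then obtain E' g' where c: "cycle (?Q @ ?P) E' g'" "insert g' (set E') = insert g1 (set E1)"
      "length E' = length E1"
      using berge_cycle_rotate_append \<open>?P \<noteq> []\<close> \<open>?Q \<noteq> []\<close> by metis
    define C' where "C' = ?Q @ ?P"
    have C': "cycle C' E' g'" "insert g' (set E') = insert g (set EC)" "length E' = length EC"
      using c c1 by (auto simp: C'_def)
    have set_C': "set C' = set C"
      unfolding C'_def using c1(3) by (metis set_append sup_commute takeWhile_dropWhile_id)
    have hd: "hd C' \<in> h" "last C' \<notin> h"
      using hdQ lastP \<open>?P \<noteq> []\<close> \<open>?Q \<noteq> []\<close> by (auto simp: C'_def)
    have d: "distinct C'" "distinct E'" "g' \<notin> set E'" "links C' E'"
      using C'(1) by (auto simp: berge_cycle_def berge_path_iff_links)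
    have len: "length C' = Suc (length E')" using links_length d(4) .
    let ?I = "{i. i < length E' \<and> C' ! i \<in> h}"
    let ?G = "insert g' ((!) E' ` ?I)"
    have "(!) C' ` ?I = h \<inter> set C"
    proof (intro equalityI subsetI)
      fix x assume x: "x \<in> h \<inter> set C"
      then obtain i where i: "i < length C'" "x = C' ! i" using set_C' by (metis IntD2 in_set_conv_nth)
      have "last C' = C' ! length E'" using len by (metis diff_Suc_1 last_conv_nth length_0_conv nat.distinct(1))
      then have "i \<noteq> length E'" using hd(2) x i(2) by auto
      then show "x \<in> (!) C' ` ?I" using i x len by auto
    next
      fix x assume "x \<in> (!) C' ` ?I"
      then obtain i where "i < length E'" "C' ! i \<in> h" "x = C' ! i" by blast
      then show "x \<in> h \<inter> set C" using nth_mem[of i C'] len set_C' by simp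
    qed
    moreover have "inj_on ((!) C') ?I" using d(1) len by (auto simp: inj_on_def nth_eq_iff_index_eq)
    ultimately have "card ?I = ?t" by (metis card_image)
    moreover have "inj_on ((!) E') ?I" using d(2) by (auto simp: inj_on_def nth_eq_iff_index_eq)
    moreover have "g' \<notin> (!) E' ` ?I" using d(3) by auto
    ultimately have card_G: "card ?G = Suc ?t" by (simp add: card_image)
    have "?G \<subseteq> ?F" using C'(2) by (auto simp: set_conv_nth)
    have "e \<notin> incident ?S" if e: "e \<in> ?G" for e
    proof -
      have "x \<notin> e" if "x \<in> ?S" for x
      proof (cases "e = g'")
        case True
        then show ?thesis using avoid[OF C'(1) set_C' C'(2,3)] hd(1) that by blast
      next
        case False
        then obtain i where i: "i < length E'" "C' ! i \<in> h" "e = E' ! i" using e by blast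
        let ?A = "take (Suc i) C'" and ?B = "drop (Suc i) C'"
        let ?EA = "take i E'" and ?EB = "drop (Suc i) E'"
        have E': "E' = ?EA @ e # ?EB" using i(1,3) by (simp add: id_take_nth_drop)
        have "cycle (?A @ ?B) (?EA @ e # ?EB) g'" using C'(1) E' by simp
        then have "cycle (?B @ ?A) (?EB @ g' # ?EA) e"
          by (rule berge_cycle_append) (use i(1) len in auto)
        moreover have "set (?B @ ?A) = set C"
          using set_C' by (metis append_take_drop_id set_append sup_commute)
        moreover have "insert e (set (?EB @ g' # ?EA)) = insert g' (set E')"
          by (subst E') auto
        moreover have "length (?EB @ g' # ?EA) = length EC" using i(1) C'(3) by simp
        moreover have "last (?B @ ?A) \<in> h"
          using i(1,2) len by (simp add: take_Suc_conv_app_nth)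
        ultimately show ?thesis using avoid C'(2) that by metis
      qed
      then show ?thesis by (auto simp: incident_def)
    qed
    then have "incident ?S \<subseteq> ?F - ?G" using inc by blast
    then have "card (incident ?S) \<le> card (?F - ?G)" by (intro card_mono) auto
    moreover have "card (?F - ?G) = k - Suc ?t"
      using card_Diff_subset[of ?G ?F] \<open>?G \<subseteq> ?F\<close> card_G F(2) by simp
    ultimately have "card (incident ?S) \<le> k - Suc ?t" by simp
    moreover have "real (k - Suc ?t) \<le> real k / (real r + 1) * real (card ?S)"
    proof -
      have "k * Suc ?t \<le> Suc r * Suc ?t" using assms(2) by (intro mult_le_mono1) simp
      then have "real k * (real ?t + 1) \<le> (real r + 1) * (real ?t + 1)"
        by (metis of_nat_Suc of_nat_le_iff of_nat_mult add.commute)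
      moreover have "real (k - Suc ?t) = real k - (real ?t + 1)" "real (r - ?t) = real r - real ?t"
        using t assms(1,2) by (auto simp: of_nat_diff)
      ultimately show ?thesis using card_S by (simp add: field_simps)
    qed
    moreover have "\<dots> \<le> weight_fn r k * real (card ?S)"
      using weight_ge_small assms(1,2) by (intro mult_right_mono) auto
    ultimately show ?thesis by linarith
  qed
  then show ?thesis
    using S_V S_ne ends by (intro settled_proper[OF goodI]) (assumption | blast)+
qed

text \<open>The end \<open>v\<close> can be exchanged for any other vertex \<open>u\<close> of
  \<open>e\<close> outside \<open>M\<close>. If \<open>u\<close> were also in \<open>f\<close>, then
  \<open>M @ [u]\<close> closed by \<open>e\<close> would be a cycle with k vertices; so
  \<open>u\<close> differs from \<open>w\<close> as well.\<close>

lemma fork_end: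
  assumes no_short: "\<nexists>vs es g. cycle vs es g \<and> Suc (length es) = k"
    and P: "path (v # M @ [w]) (e # EM @ [f])" "Suc (Suc (length EM)) = k" "M \<noteq> []"
    and u: "u \<in> e - set M"
  shows "u \<notin> f \<and> path (u # M @ [w]) (e # EM @ [f])"
proof
  have "links ([v] @ (M @ [w])) ([] @ e # (EM @ [f]))" using P(1) by (simp add: berge_path_iff_links)
  then have "v \<in> e" "hd M \<in> e" "links (M @ [w]) (EM @ f # [])"
    using P(3) links_append[of "[v]" "[]" "M @ [w]" e "EM @ [f]"] by auto
  moreover have len: "length M = Suc (length EM)" using berge_path_length[OF P(1)] by simp
  ultimately have l: "links M EM" "last M \<in> f" "w \<in> f" using links_append[OF len, of "[w]" f "[]"] by auto
  have e: "e \<in> E" using P(1) by (simp add: berge_path_def)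
  show "u \<notin> f"
  proof
    assume "u \<in> f"
    then have "links (M @ [u]) (EM @ f # [])" using l len by (subst links_append) auto
    then have "cycle (M @ [u]) (EM @ [f]) e"
      using P u sub[OF e] \<open>hd M \<in> e\<close> by (auto simp: berge_cycle_def berge_path_iff_links)
    then show False using no_short P(2) by fastforce
  qed
  then have "u \<noteq> w" using l(3) by blast
  then show "path (u # M @ [w]) (e # EM @ [f])"
    using P u sub[OF e] \<open>hd M \<in> e\<close> by (cases M) (auto simp: berge_path_iff_links)
qed

lemma settled_small:
  assumes "2 \<le> k" "k \<le> r" "path vs es" "length es = k"
  shows "\<exists>S. settled S"
proof (cases "\<exists>vs es g. cycle vs es g \<and> Suc (length es) = k")
  case True
  then show ?thesis using settled_short_cycle assms(1,2) by blast
next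
  case False
  note no_short = False
  have len: "length vs = Suc k" using berge_path_length assms(3,4) by metis
  obtain v M w where vs: "vs = v # M @ [w]" "M \<noteq> []"
  proof -
    obtain v vs' where "vs = v # vs'" "vs' \<noteq> []" using len assms(1) by (cases vs; cases "tl vs") auto
    moreover from this obtain M w where "vs' = M @ [w]" by (metis rev_exhaust)
    ultimately show ?thesis using that len assms(1) by fastforce
  qed
  obtain e EM f where es: "es = e # EM @ [f]"
  proof -
    obtain e es' where "es = e # es'" "es' \<noteq> []" using assms(1,4) by (cases es; cases "tl es") auto
    then show ?thesis using that by (metis rev_exhaust)
  qed
  have P: "path (v # M @ [w]) (e # EM @ [f])" and k: "Suc (Suc (length EM)) = k"
    using assms(3,4) vs es by auto
  have Q: "path (w # rev M @ [v]) (f # rev EM @ [e])" using berge_path_rev[OF P] by simp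
  have d: "e \<in> E" "f \<in> E" "distinct M" "set M \<subseteq> V" "distinct (e # EM @ [f])" "set EM \<subseteq> E"
    using P by (auto simp: berge_path_def)
  have len_M: "length M = Suc (length EM)" using len k vs by simp
  then have card_M: "card (set M) = k - 1" using d(3) k by (simp add: distinct_card)
  have l: "links M EM" "hd M \<in> e" "last M \<in> f"
  proof -
    have "links ([v] @ (M @ [w])) ([] @ e # (EM @ [f]))" using P by (simp add: berge_path_iff_links)
    then have "hd M \<in> e" "links (M @ [w]) (EM @ f # [])"
      using vs(2) links_append[of "[v]" "[]" "M @ [w]" e "EM @ [f]"] by auto
    then show "links M EM" "hd M \<in> e" "last M \<in> f"
      using links_append[OF len_M, of "[w]" f "[]"] by auto
  qed
  let ?A = "e - set M" and ?B = "f - set M"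
  have A: "u \<notin> f \<and> path (u # M @ [w]) (e # EM @ [f])" if "u \<in> ?A" for u
    using fork_end[OF no_short P k vs(2)] that by blast
  have B: "path (u # rev M @ [v]) (f # rev EM @ [e])" if "u \<in> ?B" for u
    using fork_end[OF no_short Q] k vs(2) that by simp
  have ends: "\<exists>ws fs. path ws fs \<and> length fs = k \<and> hd ws = u \<and> set fs = set es"
    if "u \<in> ?A \<union> ?B" for u
  proof (cases "u \<in> ?A")
    case True
    then have "path (u # M @ [w]) (e # EM @ [f])" using A by blast
    then show ?thesis using es k by fastforce
  next
    case False
    then have "path (u # rev M @ [v]) (f # rev EM @ [e])" using B that by blast
    moreover have "set (f # rev EM @ [e]) = set es" "length (f # rev EM @ [e]) = k"
      using es k by auto
    ultimately show ?thesis by (metis list.sel(1))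
  qed
  have "incident (?A \<union> ?B) \<subseteq> set es"
  proof
    fix g assume "g \<in> incident (?A \<union> ?B)"
    then obtain u where "g \<in> E" "u \<in> g" "u \<in> ?A \<union> ?B" unfolding incident_def by blast
    then show "g \<in> set es" using ends[of u] end_edge_in_path[OF assms(1,2)] by metis
  qed
  then have "card (incident (?A \<union> ?B)) \<le> card (set es)" by (intro card_mono) auto
  then have inc: "card (incident (?A \<union> ?B)) \<le> k" using card_length[of es] assms(4) by simp
  have fin: "finite ?A" "finite ?B" using fin_edge d(1,2) by auto
  have card_AB: "card (?A \<union> ?B) = card ?A + card ?B"
    using A fin by (intro card_Un_disjoint) auto
  let ?a = "card (e \<inter> set M)" and ?b = "card (f \<inter> set M)"
  have card_rest: "card (g - set M) = r - card (g \<inter> set M)" "card (g \<inter> set M) \<le> r" if "g \<in> E" for g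
    using card_Diff_subset_Int[of g "set M"] card_mono[OF fin_edge[OF that], of "g \<inter> set M"]
      card_edge[OF that] fin_edge[OF that] by auto
  note ab = card_rest(1)[OF d(1)] card_rest(1)[OF d(2)] card_rest(2)[OF d(1)] card_rest(2)[OF d(2)]
  show ?thesis
  proof (cases "real k \<le> weight_fn r k * real (card (?A \<union> ?B))")
    case True
    then have "?A \<union> ?B \<noteq> {}" using k1 by force
    moreover have "?A \<union> ?B \<noteq> V" using vs(2) d(4) by (cases M) auto
    moreover have "?A \<union> ?B \<subseteq> V" using sub d(1,2) by blast
    moreover have "real (card (incident (?A \<union> ?B))) \<le> weight_fn r k * real (card (?A \<union> ?B))"
      using inc True by linarith
    ultimately have "settled (?A \<union> ?B)"
      using ends by (intro settled_proper[OF goodI]) (assumption | blast)+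
    then show ?thesis by blast
  next
    case False
    \<comment> \<open>The possible ends number 2r - a - b. If they cannot carry k edges, there are
      at most r of them, and fewer than r when k = r.\<close>
    have "k < ?a + ?b"
    proof (cases "k = r")
      case True
      then show ?thesis using False weight_r card_AB ab by simp
    next
      case ne: False
      have "card (?A \<union> ?B) < r + 1"
      proof (rule ccontr)
        assume "\<not> card (?A \<union> ?B) < r + 1"
        then have "real k / (real r + 1) * (real r + 1) \<le> weight_fn r k * real (card (?A \<union> ?B))"
          using weight_ge_small[OF assms(1,2)] weight_fn_pos[OF r3 k1] by (intro mult_mono) auto
        then show False using False by simp
      qed
      then show ?thesis using card_AB ab ne assms(2) by simp
    qed
    \<comment> \<open>Two subsets of {0..<k} of total size greater than k meet: this gives crossing chords.\<close>
    let ?I = "{i. i < length M \<and> M ! i \<in> e}" and ?J = "{i. i < length M \<and> M ! i \<in> f}"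
    have card_nth: "card {i. i < length M \<and> M ! i \<in> g} = card (g \<inter> set M)" for g
    proof -
      have "(!) M ` {i. i < length M \<and> M ! i \<in> g} = g \<inter> set M"
        by (auto simp: set_conv_nth)
      moreover have "inj_on ((!) M) {i. i < length M \<and> M ! i \<in> g}"
        using d(3) by (auto simp: inj_on_def nth_eq_iff_index_eq)
      ultimately show ?thesis by (metis card_image)
    qed
    have "?I \<inter> Suc ` ?J \<noteq> {}"
    proof
      assume "?I \<inter> Suc ` ?J = {}"
      then have "card (?I \<union> Suc ` ?J) = ?a + ?b"
        by (subst card_Un_disjoint) (auto simp: card_image card_nth)
      moreover have "card (?I \<union> Suc ` ?J) \<le> card {..<k}"
        using len_M k by (intro card_mono) auto
      ultimately show False using \<open>k < ?a + ?b\<close> by simp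
    qed
    then obtain j where j: "Suc j < length M" "M ! Suc j \<in> e" "M ! j \<in> f" by auto
    let ?M1 = "take (Suc j) M" and ?M2 = "drop (Suc j) M"
    have ne: "?M1 \<noteq> []" "?M2 \<noteq> []" using j(1) by auto
    have ends12: "last ?M1 \<in> f" "hd ?M2 \<in> e"
      using j by (auto simp: take_Suc_conv_app_nth hd_drop_conv_nth)
    have "links (?M1 @ ?M2) EM" using l(1) by simp
    then obtain E1 h E2 where EM: "EM = E1 @ h # E2" "length ?M1 = Suc (length E1)"
      "links ?M1 E1" "links ?M2 E2" "last ?M1 \<in> h"
      using links_split_at[OF _ ne] by metis
    have M12: "set ?M1 \<union> set ?M2 = set M" "distinct ?M1" "distinct ?M2" "set ?M1 \<inter> set ?M2 = {}"
      using d(3) by (auto simp: set_take_disj_set_drop_if_distinct simp flip: set_append)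
    \<comment> \<open>The chords close the inner vertices to a cycle with k - 1 vertices:
      \<open>f\<close> joins \<open>last ?M1\<close> to \<open>last M\<close>, and \<open>e\<close>
      joins \<open>hd ?M2\<close> to \<open>hd M\<close>. The path edge \<open>h\<close> between the
      two pieces is set free and becomes the attached edge.\<close>
    have "links (?M1 @ rev ?M2) (E1 @ f # rev E2)"
      using EM ends12 ne d(3) by (subst links_append) (auto simp: hd_rev last_drop l(3) j(1))
    then have "path (?M1 @ rev ?M2) (E1 @ f # rev E2)"
      using d M12 EM(1) unfolding berge_path_iff_links by auto
    moreover have "hd ?M1 = hd M" by simp
    ultimately have "cycle (?M1 @ rev ?M2) (E1 @ f # rev E2) e"
      using d EM(1) ne ends12 l(2) vs(2) by (auto simp: berge_cycle_def last_rev)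
    moreover have "Suc (Suc (length (E1 @ f # rev E2))) = k" using EM(1) k by simp
    moreover have "h \<in> E" "h \<notin> insert e (set (E1 @ f # rev E2))" using d EM(1) by auto
    moreover have "h \<inter> set (?M1 @ rev ?M2) \<noteq> {}" using EM(5) ne(1) last_in_set by fastforce
    moreover have "3 \<le> k" using k EM(1) by simp
    ultimately have "settled (h - set (?M1 @ rev ?M2))"
      using settled_lollipop[OF _ assms(2) no_short] by blast
    then show ?thesis by blast
  qed
qed

end

section \<open>Longest paths with more than r edges\<close>

lemma le_choose: "1 \<le> j \<Longrightarrow> j < n \<Longrightarrow> n \<le> n choose j"
proof (induction n)
  case (Suc n)
  then obtain i where j: "j = Suc i" by (cases j) auto
  show ?case
  proof (cases "j = n")
    case True
    then show ?thesis by (simp add: binomial_symmetric[of n "Suc n"])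
  next
    case False
    then have "n \<le> n choose j" using Suc by simp
    moreover have "0 < n choose i" using Suc.prems j by simp
    ultimately show ?thesis unfolding j binomial_Suc_Suc by linarith
  qed
qed simp

lemma double_choose_two: "2 * (n choose 2) = n * (n - 1)"
proof -
  have "even (n * (n - 1))" by (cases n) auto
  then show ?thesis by (simp add: choose_two)
qed

text \<open>The first bound lets two ends carry k edges; the second lets one end carry k - r + 1
  edges.\<close>

lemma choose_bound_pair:
  assumes "3 \<le> r" "r + 1 \<le> k"
  shows "r * k \<le> 2 * (k choose (r - 1)) \<and> r * (k - r + 1) \<le> k choose (r - 1)"
  using assms(2)
proof (induction k rule: dec_induct)
  case base
  have "(r + 1) choose (r - 1) = (r + 1) choose 2"
    using assms(1) binomial_symmetric[of "r - 1" "r + 1"] by (simp add: numeral_2_eq_2)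
  moreover have "2 * ((r + 1) choose 2) = (r + 1) * r" using double_choose_two[of "r + 1"] by simp
  moreover have "4 * r \<le> (r + 1) * r" using assms(1) by (intro mult_le_mono1) simp
  moreover have "r * (r + 1 - r + 1) = 2 * r" "r * (r + 1) = (r + 1) * r" by simp_all
  ultimately show ?case by linarith
next
  case (step k)
  obtain s where r: "r = Suc (Suc s)" "1 \<le> s"
    using assms(1) by (metis One_nat_def Suc_le_D Suc_le_mono numeral_3_eq_3)
  have "k \<le> k choose s" using r step by (intro le_choose) auto
  moreover have "Suc k choose (r - 1) = (k choose s) + (k choose (r - 1))" using r by simp
  moreover have "r * Suc k = r * k + r" "r * (Suc k - r + 1) = r * (k - r + 1) + r"
    using step(1) by (simp_all add: Suc_diff_le)
  ultimately show ?case using step.IH step(1) by linarith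
qed

text \<open>Among x couples, the left side counts the sets of j people that contain no complete
  couple.\<close>

lemma power_two_choose_le: "2 ^ j * (x choose j) \<le> (2 * x) choose j"
proof (induction x arbitrary: j)
  case 0
  then show ?case by (cases j) auto
next
  case (Suc x)
  show ?case
  proof (cases j)
    case (Suc i)
    have "2 ^ Suc i * (Suc x choose Suc i) = 2 * (2 ^ i * (x choose i)) + 2 ^ Suc i * (x choose Suc i)"
      by (simp add: algebra_simps)
    also have "\<dots> \<le> 2 * ((2 * x) choose i) + ((2 * x) choose Suc i)"
      using Suc.IH[of i] Suc.IH[of "Suc i"] by (intro add_mono mult_le_mono2) auto
    also have "\<dots> \<le> (2 * Suc x) choose Suc i" by (cases i) auto
    finally show ?thesis using Suc by simp
  qed simp
qed

text \<open>For s = 2 this fails (9 against 6), which is why r = 3, where s = r - 1 = 2, needs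
  separate estimates.\<close>

lemma square_le_central_binomial: "3 \<le> s \<Longrightarrow> (s + 1) ^ 2 \<le> (2 * s) choose s"
proof (induction s rule: dec_induct)
  case base
  show ?case by (simp add: numeral_eq_Suc)
next
  case (step s)
  have "2 \<le> s * s" using step(1) mult_le_mono[of 2 s 1 s] by simp
  then have "(Suc s + 1) ^ 2 \<le> 2 * (s + 1) ^ 2"
    by (simp add: power2_eq_square)
  also have "\<dots> \<le> 2 * ((2 * s) choose s)" using step by simp
  also have "\<dots> \<le> (2 * Suc s) choose Suc s" by (cases s) auto
  finally show ?case .
qed

text \<open>With s = r - 1, the left factor bounds the degree of the end whose neighbourhood has x
  vertices: at most k - x path edges, and (x choose s) others. The induction on k starts at 2x, and
  there a second one on x starts at s.\<close>

lemma choose_bound_half: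
  assumes "3 \<le> s" "s \<le> x" "2 * x \<le> k"
  shows "(s + 1) * ((k - x) + (x choose s)) \<le> k choose s"
  using assms(3)
proof (induction k rule: dec_induct)
  case base
  have "(s + 1) * (x + (x choose s)) \<le> (2 * x) choose s"
    using assms(2)
  proof (induction x rule: dec_induct)
    case base
    then show ?case using square_le_central_binomial[OF assms(1)] by (simp add: power2_eq_square)
  next
    case (step x)
    obtain j where s: "s = Suc j" using assms(1) by (cases s) auto
    have "s + 1 \<le> 2 ^ j"
      using assms(1) unfolding s
    proof (induction j)
      case (Suc j)
      then show ?case by (cases "j = 1") auto
    qed simp
    moreover have "1 \<le> x choose j" using step s by (simp add: Suc_le_eq)
    ultimately have "(s + 1) * (1 + (x choose j)) \<le> 2 ^ j * (2 * (x choose j))"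
      by (intro mult_le_mono) auto
    also have "\<dots> \<le> 2 * ((2 * x) choose j)" using power_two_choose_le[of j x] by simp
    finally have "(s + 1) * (1 + (x choose j)) \<le> 2 * ((2 * x) choose j)" .
    moreover have "((2 * x) choose s) + 2 * ((2 * x) choose j) \<le> (2 * Suc x) choose s"
      unfolding s by (cases j) auto
    moreover have "(s + 1) * (Suc x + (Suc x choose s)) =
        (s + 1) * (x + (x choose s)) + (s + 1) * (1 + (x choose j))"
      unfolding s by (simp add: algebra_simps)
    ultimately show ?case using step.IH by linarith
  qed
  then show ?case by (simp add: mult_2)
next
  case (step k)
  obtain j where s: "s = Suc j" "1 \<le> j" using assms(1) by (cases s) auto
  have "k \<le> k choose j" using s step assms by (intro le_choose) auto
  moreover have "s + 1 \<le> k" using step assms by simp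
  moreover have "(s + 1) * ((Suc k - x) + (x choose s)) = (s + 1) * ((k - x) + (x choose s)) + (s + 1)"
    using step by (simp add: Suc_diff_le algebra_simps)
  moreover have "Suc k choose s = (k choose j) + (k choose s)" using s by simp
  ultimately show ?case using step.IH by linarith
qed

lemma choose_two_bound_tight:
  assumes "2 \<le> x" "2 * x \<le> k"
  shows "3 * ((x choose 2) + x - 1) \<le> k choose 2"
proof -
  obtain c where c: "x = 2 + c" using assms(1) le_Suc_ex by blast
  obtain d where d: "k = 2 * x + d" using assms(2) le_Suc_ex by blast
  have "c \<le> c * c" by (cases c) auto
  then have "3 * (x * (x - 1) + 2 * (x - 1)) \<le> k * (k - 1)"
    unfolding d c by (simp add: algebra_simps trans_le_add1)
  moreover have "(x choose 2) + x - 1 = (x choose 2) + (x - 1)" using assms(1) by simp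
  ultimately show ?thesis using double_choose_two[of x] double_choose_two[of k] by simp
qed

text \<open>At x = 2 and k = 5 the claim would read 12 against 10; this is the exceptional case for
  r = 3.\<close>

lemma choose_two_bound_slack:
  assumes "2 \<le> x" "2 * x + 1 \<le> k" "\<not> (x = 2 \<and> k = 5)"
  shows "3 * ((k - x) + (x choose 2)) \<le> k choose 2"
proof -
  have "6 * (k - x) + 3 * (x * (x - 1)) \<le> k * (k - 1)"
  proof (cases "x = 2")
    case True
    then have "6 \<le> k" using assms by auto
    then obtain d where "k = 6 + d" using le_Suc_ex by blast
    then show ?thesis using True by (simp add: algebra_simps)
  next
    case False
    then obtain c where c: "x = 3 + c" using assms(1) le_Suc_ex[of 3 x] by auto
    obtain d where d: "k = 2 * x + 1 + d" using assms(2) le_Suc_ex by blast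
    show ?thesis unfolding d c by (simp add: algebra_simps)
  qed
  then show ?thesis using double_choose_two[of x] double_choose_two[of k] by simp
qed

section \<open>Loose edges at the ends of a path\<close>

context max_berge
begin

text \<open>\<open>F\<close> will be the set of defining edges of a path. Only this set enters, so
  rotations that keep it also keep \<open>loose\<close> and \<open>nbr\<close>.\<close>

definition loose :: "'a set set \<Rightarrow> 'a \<Rightarrow> 'a set set" where
  "loose F v = {e \<in> E - F. v \<in> e}"

definition nbr :: "'a set set \<Rightarrow> 'a \<Rightarrow> 'a set" where
  "nbr F v = \<Union> (loose F v) - {v}"

lemma incident_singleton: "incident {v} = {e \<in> E. v \<in> e}"
  by (auto simp: incident_def)

lemma finite_nbr: "finite (nbr F v)"
  by (rule finite_subset[OF _ finV]) (use sub in \<open>auto simp: nbr_def loose_def\<close>)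

text \<open>An edge at \<open>v\<close> is determined by its other r - 1 vertices. The family is
  arbitrary, so that a path edge inside the neighbourhood can be counted along with the loose
  ones.\<close>

lemma card_edges_at_le:
  assumes "\<G> \<subseteq> E" "\<And>g. g \<in> \<G> \<Longrightarrow> v \<in> g \<and> g - {v} \<subseteq> N" "finite N"
  shows "card \<G> \<le> card N choose (r - 1)"
proof -
  have "inj_on (\<lambda>g. g - {v}) \<G>"
    using assms(2) by (intro inj_onI) blast
  then have "card \<G> = card ((\<lambda>g. g - {v}) ` \<G>)" by (simp add: card_image)
  also have "\<dots> \<le> card {A. A \<subseteq> N \<and> card A = r - 1}"
  proof (intro card_mono)
    show "(\<lambda>g. g - {v}) ` \<G> \<subseteq> {A. A \<subseteq> N \<and> card A = r - 1}"
      using assms(1,2) card_edge by (auto simp: card_Diff_singleton_if subset_iff)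
  qed (use assms(3) in simp)
  also have "\<dots> = card N choose (r - 1)" using n_subsets[OF assms(3)] .
  finally show ?thesis .
qed

lemma card_loose_le: "card (loose F v) \<le> card (nbr F v) choose (r - 1)"
  by (rule card_edges_at_le[OF _ _ finite_nbr]) (auto simp: loose_def nbr_def)

lemma loose_empty_iff: "loose F v = {} \<longleftrightarrow> nbr F v = {}"
proof
  assume N: "nbr F v = {}"
  show "loose F v = {}"
  proof (rule ccontr)
    assume "loose F v \<noteq> {}"
    then obtain e where "e \<in> E" "e \<subseteq> {v}" using N by (auto simp: loose_def nbr_def)
    then have "card e \<le> 1" using card_mono[of "{v}" e] by simp
    then show False using card_edge[OF \<open>e \<in> E\<close>] r3 by simp
  qed
qed (simp add: nbr_def)

lemma nbr_card_ge: "card (nbr F v) \<noteq> 0 \<Longrightarrow> r - 1 \<le> card (nbr F v)"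
proof -
  assume "card (nbr F v) \<noteq> 0"
  then have "nbr F v \<noteq> {}" by force
  then obtain e where e: "e \<in> E" "v \<in> e" "e - {v} \<subseteq> nbr F v"
    by (auto simp: loose_def nbr_def)
  then have "card (e - {v}) \<le> card (nbr F v)" by (intro card_mono finite_nbr)
  then show ?thesis using e card_edge by (simp add: card_Diff_singleton_if)
qed

lemma card_incident_singleton:
  assumes "F \<subseteq> E"
  shows "card (incident {v}) \<le> card {e \<in> F. v \<in> e} + card (loose F v)"
proof -
  have "incident {v} = {e \<in> F. v \<in> e} \<union> loose F v"
    using assms by (auto simp: incident_singleton loose_def)
  then show ?thesis by (simp add: card_Un_le)
qed

lemma weight_large_ge:
  assumes "r \<le> k" "r * m \<le> n * (k choose (r - 1))"
  shows "real m \<le> weight_fn r k * real n"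
proof -
  have "real r * real m \<le> real n * real (k choose (r - 1))"
    using assms(2) by (metis of_nat_le_iff of_nat_mult)
  then show ?thesis using assms(1) r3 by (simp add: weight_fn_large field_simps)
qed

lemma settled_end:
  assumes "path vs es" "length es = k" "r \<le> k" "card (incident {hd vs}) \<le> d"
    "r * d \<le> k choose (r - 1)"
  shows "\<exists>S. settled S"
proof -
  have "hd vs \<in> V"
    using assms(1) berge_path_not_Nil by (metis berge_path_def hd_in_set subsetD)
  moreover have "card V > 1" using berge_path_length_less[OF finV assms(1)] assms(2) k1 by simp
  then have "{hd vs} \<noteq> V" by auto
  moreover have "real (card (incident {hd vs})) \<le> weight_fn r k * real (card {hd vs})"
    using weight_large_ge[of d 1] assms(3,4,5) by simp
  ultimately have "settled {hd vs}"
    using assms(1,2) by (intro settled_proper[OF goodI]) auto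
  then show ?thesis by blast
qed

end

section \<open>Rotations and crossing edges\<close>

context max_berge_no_long
begin

lemma no_common_edge:
  assumes "path vs es" "length es = k" "e \<in> E" "e \<notin> set es" "hd vs \<in> e"
  shows "last vs \<notin> e"
  using assms no_long[of vs es e] by (auto simp: berge_cycle_def)

lemma nbr_hd_subset: "path vs es \<Longrightarrow> length es = k \<Longrightarrow> nbr (set es) (hd vs) \<subseteq> set vs - {hd vs}"
  using end_edge_subset[of vs es] by (auto simp: nbr_def loose_def)

lemma nbr_last_subset: "path vs es \<Longrightarrow> length es = k \<Longrightarrow> nbr (set es) (last vs) \<subseteq> set vs - {last vs}"
  using nbr_hd_subset[of "rev vs" "rev es"] berge_path_rev[of V E vs es]
  by (auto simp: hd_rev)

text \<open>Rotation at position \<open>i\<close>, with the last vertex kept. A chord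
  \<open>f\<close> may be loose, or be the path edge \<open>es ! i\<close> itself; in the latter
  case the edge set does not change.\<close>

lemma path_rotate_nth:
  assumes P: "path vs es" and i: "i < length es"
    and f: "f \<in> E" "f = es ! i \<or> f \<notin> set es" "hd vs \<in> f" "vs ! Suc i \<in> f"
  obtains vs' es' where "path vs' es'" "length es' = length es" "hd vs' = vs ! i" "last vs' = last vs"
    "set es' \<subseteq> insert f (set es)" "f = es ! i \<Longrightarrow> set es' = set es"
proof -
  let ?A = "take (Suc i) vs" and ?B = "drop (Suc i) vs"
  let ?EA = "take i es" and ?EB = "drop (Suc i) es"
  have len: "length vs = Suc (length es)" using berge_path_length[OF P] .
  have es: "es = ?EA @ es ! i # ?EB" using i by (simp add: id_take_nth_drop)
  have "distinct (?EA @ es ! i # ?EB)" using P es by (metis berge_path_def)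
  then have "f \<notin> set ?EA" "f \<notin> set ?EB"
    using f(2) set_take_subset[of i es] set_drop_subset[of "Suc i" es] by auto
  moreover have "path (?A @ ?B) (?EA @ es ! i # ?EB)" using P es by simp
  moreover have "hd ?B = vs ! Suc i" using len i by (simp add: hd_drop_conv_nth)
  ultimately have P': "path (rev ?A @ ?B) (rev ?EA @ f # ?EB)"
    using f len i by (intro berge_path_rotate[where e = "es ! i"]) auto
  have set_es: "set es = set ?EA \<union> {es ! i} \<union> set ?EB" by (subst es) auto
  show ?thesis
  proof (rule that[OF P'])
    show "hd (rev ?A @ ?B) = vs ! i" using len i by (simp add: take_Suc_conv_app_nth)
    show "last (rev ?A @ ?B) = last vs" using len i by simp
    show "length (rev ?EA @ f # ?EB) = length es" using i by simp
    show "set (rev ?EA @ f # ?EB) \<subseteq> insert f (set es)" using set_es by auto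
    show "set (rev ?EA @ f # ?EB) = set es" if "f = es ! i" using set_es that by auto
  qed
qed

text \<open>Otherwise rotation brings \<open>vs ! i\<close> to the front, and the loose edge
  \<open>g\<close> joining it to the last vertex closes a cycle with k + 1 vertices. The chord
  differs from \<open>g\<close> because no loose edge contains both ends.\<close>

lemma index_disjoint:
  assumes P: "path vs es" "length es = k" and i: "i < k"
    and ab: "hd vs \<in> es ! i \<or> vs ! Suc i \<in> nbr (set es) (hd vs)"
  shows "vs ! i \<notin> nbr (set es) (last vs)"
proof
  assume "vs ! i \<in> nbr (set es) (last vs)"
  then obtain g where g: "g \<in> E" "g \<notin> set es" "last vs \<in> g" "vs ! i \<in> g"
    by (auto simp: nbr_def loose_def)
  have "\<exists>f. f \<in> E \<and> (f = es ! i \<or> f \<notin> set es) \<and> hd vs \<in> f \<and> vs ! Suc i \<in> f"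
  proof (cases "hd vs \<in> es ! i")
    case True
    moreover have "es ! i \<in> E" using P i by (auto simp: berge_path_def)
    ultimately show ?thesis using P i by (intro exI[of _ "es ! i"]) (auto simp: berge_path_def)
  next
    case False
    then show ?thesis using ab by (auto simp: nbr_def loose_def)
  qed
  then obtain f where f: "f \<in> E" "f = es ! i \<or> f \<notin> set es" "hd vs \<in> f" "vs ! Suc i \<in> f" by blast
  have "g \<noteq> f"
  proof
    assume "g = f"
    then show False using no_common_edge[OF P, of g] f(3) g by blast
  qed
  obtain vs' es' where "path vs' es'" "length es' = length es" "hd vs' = vs ! i" "last vs' = last vs"
    "set es' \<subseteq> insert f (set es)"
    using path_rotate_nth[OF P(1) _ f] P(2) i by metis
  then show False using no_long[of vs' es' g] g P(2) \<open>g \<noteq> f\<close> by (auto simp: berge_cycle_def)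
qed

text \<open>Each set misses one end of the path, so one can be indexed by i + 1 and the other by i,
  both with i < k. This is the shift under which the two neighbourhoods are disjoint.\<close>

lemma card_nth_image:
  assumes "path vs es" "length es = k" "N \<subseteq> set vs - {hd vs}" "M \<subseteq> set vs - {last vs}"
  shows "card {i. i < k \<and> vs ! Suc i \<in> N} = card N" "card {i. i < k \<and> vs ! i \<in> M} = card M"
proof -
  have d: "distinct vs" and len: "length vs = Suc k" using assms by (auto simp: berge_path_def)
  then have "vs \<noteq> []" by auto
  then have hd: "hd vs = vs ! 0" and last: "last vs = vs ! k"
    using len by (simp_all add: hd_conv_nth last_conv_nth)
  have "(\<lambda>i. vs ! Suc i) ` {i. i < k \<and> vs ! Suc i \<in> N} = N"
  proof (intro equalityI subsetI)
    fix u assume u: "u \<in> N"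
    then obtain j where j: "j < length vs" "u = vs ! j" using assms(3) by (metis DiffD1 in_set_conv_nth subsetD)
    moreover have "j \<noteq> 0" using u j assms(3) hd by auto
    ultimately obtain i where "j = Suc i" by (cases j) auto
    then show "u \<in> (\<lambda>i. vs ! Suc i) ` {i. i < k \<and> vs ! Suc i \<in> N}" using u j len by auto
  qed auto
  moreover have "inj_on (\<lambda>i. vs ! Suc i) {i. i < k \<and> vs ! Suc i \<in> N}"
    using d len by (auto simp: inj_on_def nth_eq_iff_index_eq)
  ultimately show "card {i. i < k \<and> vs ! Suc i \<in> N} = card N" by (metis card_image)
  have "(\<lambda>i. vs ! i) ` {i. i < k \<and> vs ! i \<in> M} = M"
  proof (intro equalityI subsetI)
    fix u assume u: "u \<in> M"
    then obtain j where j: "j < length vs" "u = vs ! j" using assms(4) by (metis DiffD1 in_set_conv_nth subsetD)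
    moreover have "j \<noteq> k" using u j assms(4) last by auto
    ultimately show "u \<in> (\<lambda>i. vs ! i) ` {i. i < k \<and> vs ! i \<in> M}" using u len by auto
  qed auto
  moreover have "inj_on (\<lambda>i. vs ! i) {i. i < k \<and> vs ! i \<in> M}"
    using d len by (auto simp: inj_on_def nth_eq_iff_index_eq)
  ultimately show "card {i. i < k \<and> vs ! i \<in> M} = card M" by (metis card_image)
qed

lemma card_tight_nth:
  assumes "path vs es" "length es = k"
  shows "card {e \<in> set es. v \<in> e} = card {i. i < k \<and> v \<in> es ! i}"
proof -
  have "(\<lambda>i. es ! i) ` {i. i < k \<and> v \<in> es ! i} = {e \<in> set es. v \<in> e}"
    using assms(2) by (auto simp: in_set_conv_nth)
  moreover have "inj_on (\<lambda>i. es ! i) {i. i < k \<and> v \<in> es ! i}"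
    using assms by (auto simp: inj_on_def nth_eq_iff_index_eq berge_path_def)
  ultimately show ?thesis by (metis card_image)
qed

text \<open>Positions of path edges at the first vertex, or of its neighbours, are disjoint from
  those of the neighbours of the last vertex, inside {0..<k}.\<close>

lemma end_counts:
  assumes P: "path vs es" "length es = k"
  shows "card {e \<in> set es. hd vs \<in> e} + card (nbr (set es) (last vs)) \<le> k"
    and "card (nbr (set es) (hd vs)) + card (nbr (set es) (last vs)) \<le> k"
proof -
  let ?X = "{i. i < k \<and> hd vs \<in> es ! i}" and ?N = "{i. i < k \<and> vs ! Suc i \<in> nbr (set es) (hd vs)}"
    and ?L = "{i. i < k \<and> vs ! i \<in> nbr (set es) (last vs)}"
  have L: "card ?L = card (nbr (set es) (last vs))" and N: "card ?N = card (nbr (set es) (hd vs))"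
    using card_nth_image[OF P nbr_hd_subset[OF P] nbr_last_subset[OF P]] by simp_all
  have "card ?X + card ?L = card (?X \<union> ?L)" "card ?N + card ?L = card (?N \<union> ?L)"
    using index_disjoint[OF P] by (subst card_Un_disjoint; force)+
  moreover have "card (?X \<union> ?L) \<le> card {..<k}" "card (?N \<union> ?L) \<le> card {..<k}"
    by (intro card_mono; auto)+
  ultimately show "card {e \<in> set es. hd vs \<in> e} + card (nbr (set es) (last vs)) \<le> k"
    "card (nbr (set es) (hd vs)) + card (nbr (set es) (last vs)) \<le> k"
    using L N card_tight_nth[OF P] by auto
qed

text \<open>When the two neighbourhoods exhaust the path, the first edge can be exchanged for a loose one, so
  it also lies inside the neighbourhood and is already counted by the binomial coefficient.\<close>

lemma card_incident_hd_tight: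
  assumes P: "path vs es" "length es = k"
    and sum: "card (nbr (set es) (hd vs)) + card (nbr (set es) (last vs)) = k"
  defines "x \<equiv> card (nbr (set es) (hd vs))"
  shows "card (incident {hd vs}) \<le> (x choose (r - 1)) + x - 1"
proof -
  let ?X = "{i. i < k \<and> hd vs \<in> es ! i}" and ?N = "{i. i < k \<and> vs ! Suc i \<in> nbr (set es) (hd vs)}"
    and ?L = "{i. i < k \<and> vs ! i \<in> nbr (set es) (last vs)}"
  have L: "card ?L = card (nbr (set es) (last vs))" and N: "card ?N = x"
    using card_nth_image[OF P nbr_hd_subset[OF P] nbr_last_subset[OF P]] by (simp_all add: x_def)
  have "card (?N \<union> ?L) = card ?N + card ?L"
    using index_disjoint[OF P] by (subst card_Un_disjoint) auto
  \<comment> \<open>The two index sets now partition all positions, so every path edge at the first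
    vertex sits at a position of \<open>?N\<close>.\<close>
  then have cover: "?N \<union> ?L = {..<k}"
    using L N sum by (intro card_subset_eq) (auto simp: x_def)
  then have X: "?X \<subseteq> ?N" using index_disjoint[OF P] by blast
  obtain e1 EB where es: "es = e1 # EB" using P(2) k1 by (cases es) auto
  obtain v0 v1 B where vs: "vs = v0 # v1 # B"
    using berge_path_length[OF P(1)] P(2) k1 by (cases vs; cases "tl vs") auto
  have path: "v0 \<in> e1" "v1 \<in> e1" "e1 \<in> E" "e1 \<notin> set EB"
    using P(1) vs es by (auto simp: berge_path_iff_links)
  then have "0 \<in> ?X" using es vs k1 by simp
  then have "0 \<in> ?N" using X by blast
  then obtain e where e: "e \<in> E" "e \<notin> set es" "v0 \<in> e" "v1 \<in> e"
    using vs by (auto simp: nbr_def loose_def)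
  \<comment> \<open>Exchange \<open>e1\<close> for the loose edge \<open>e\<close>, which also
    contains the first two vertices.\<close>
  have P': "path vs (e # EB)" "length (e # EB) = k"
    using P e vs es by (auto simp: berge_path_iff_links)
  have e1: "e1 \<notin> set (e # EB)" using e(2) path(4) es by auto
  have "last vs \<notin> e" using no_common_edge[OF P e(1,2)] e(3) vs by simp
  moreover have "last vs \<notin> e1" using no_common_edge[OF P' path(3) e1] path(1) vs by simp
  ultimately have "loose (set (e # EB)) (last vs) = loose (set es) (last vs)"
    using es by (auto simp: loose_def)
  then have nbr_last: "nbr (set (e # EB)) (last vs) = nbr (set es) (last vs)" by (simp add: nbr_def)
  \<comment> \<open>The new neighbours must avoid the same positions \<open>?L\<close>, and all
    remaining positions already belong to \<open>?N\<close>.\<close>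
  have nbr': "nbr (set (e # EB)) (hd vs) \<subseteq> nbr (set es) (hd vs)"
  proof
    fix u assume u: "u \<in> nbr (set (e # EB)) (hd vs)"
    then have "u \<in> set (v1 # B)" using nbr_hd_subset[OF P'] vs by auto
    then obtain i where i: "i < length (v1 # B)" "u = (v1 # B) ! i" by (metis in_set_conv_nth)
    then have "i < k" "u = vs ! Suc i" using vs berge_path_length[OF P(1)] P(2) by simp_all
    then have "i \<notin> ?L" using index_disjoint[OF P', of i] u nbr_last by auto
    then have "i \<in> ?N" using cover \<open>i < k\<close> by blast
    then show "u \<in> nbr (set es) (hd vs)" using \<open>u = vs ! Suc i\<close> by simp
  qed
  have "e1 \<in> loose (set (e # EB)) (hd vs)" using path e1 vs by (simp add: loose_def)
  then have "e1 - {hd vs} \<subseteq> nbr (set es) (hd vs)" using nbr' by (auto simp: nbr_def)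
  then have "card (insert e1 (loose (set es) (hd vs))) \<le> x choose (r - 1)"
    unfolding x_def using path vs
    by (intro card_edges_at_le[of _ "hd vs"] finite_nbr) (auto simp: loose_def nbr_def)
  moreover have "card {e \<in> set es. hd vs \<in> e} \<le> x"
    using card_tight_nth[OF P] card_mono[OF _ X] N by simp
  moreover have "e1 \<in> {e \<in> set es. hd vs \<in> e}" using path vs es by simp
  then have "card ({e \<in> set es. hd vs \<in> e} - {e1}) = card {e \<in> set es. hd vs \<in> e} - 1"
    by simp
  moreover have "incident {hd vs} = insert e1 (loose (set es) (hd vs)) \<union> ({e \<in> set es. hd vs \<in> e} - {e1})"
    using P(1) path vs by (auto simp: incident_singleton loose_def berge_path_def)
  then have "card (incident {hd vs}) \<le> card (insert e1 (loose (set es) (hd vs))) +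
      card ({e \<in> set es. hd vs \<in> e} - {e1})"
    by (simp only: card_Un_le)
  moreover have "1 \<le> x" using \<open>0 \<in> ?N\<close> N card_0_eq[of ?N] by auto
  ultimately show ?thesis by linarith
qed

lemma settled_large:
  assumes rk: "r + 1 \<le> k" and P0: "path vs0 es0" "length es0 = k"
  shows "\<exists>S. settled S"
proof -
  define nh where "nh es vs = card (nbr (set es) (hd vs))" for es and vs :: "'a list"
  define nl where "nl es vs = card (nbr (set es) (last vs))" for es and vs :: "'a list"
  \<comment> \<open>Reversal makes the first vertex the one with the smaller neighbourhood.\<close>
  have "\<exists>vs es. path vs es \<and> length es = k \<and> nh es vs \<le> nl es vs"
  proof (cases "nh es0 vs0 \<le> nl es0 vs0")
    case False
    then have "nh (rev es0) (rev vs0) \<le> nl (rev es0) (rev vs0)"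
      by (simp add: nh_def nl_def hd_rev last_rev)
    then show ?thesis using P0 berge_path_rev[OF P0(1)] by (metis length_rev)
  qed (use P0 in blast)
  then obtain vs es where P: "path vs es" "length es = k" and le: "nh es vs \<le> nl es vs" by blast
  define x where "x = nh es vs"
  define y where "y = nl es vs"
  have xy: "x \<le> y" using le by (simp add: x_def y_def)
  have counts: "card {e \<in> set es. hd vs \<in> e} + y \<le> k" "x + y \<le> k"
    using end_counts[OF P] by (simp_all add: x_def y_def nh_def nl_def)
  have es_E: "set es \<subseteq> E" using P(1) by (simp add: berge_path_def)
  have vs_ne: "vs \<noteq> []" using berge_path_not_Nil P(1) .
  have card_V: "k + 1 \<le> card V" using berge_path_length_less[OF finV P(1)] P(2) by simp
  have deg: "card (incident {hd vs}) \<le> card {e \<in> set es. hd vs \<in> e} + (x choose (r - 1))"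
    using card_incident_singleton[OF es_E, of "hd vs"] card_loose_le[of "set es" "hd vs"]
    by (simp add: x_def nh_def)
  have x_ge: "r - 1 \<le> x" if "x \<noteq> 0"
    using that nbr_card_ge unfolding x_def nh_def by blast
  have y_ge: "r - 1 \<le> y" if "y \<noteq> 0"
    using that nbr_card_ge unfolding y_def nl_def by blast
  note pair = choose_bound_pair[OF r3 rk]
  consider "y = 0" | "x = 0" "y \<noteq> 0" | "x \<noteq> 0" "4 \<le> r" | "x \<noteq> 0" "r = 3" using r3 by linarith
  then show ?thesis
  proof cases
    case 1
    let ?S = "{hd vs, last vs}"
    have "nbr (set es) (hd vs) = {}" "nbr (set es) (last vs) = {}"
      using 1 xy card_0_eq[OF finite_nbr] by (auto simp: x_def y_def nh_def nl_def)
    then have "loose (set es) (hd vs) = {}" "loose (set es) (last vs) = {}"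
      using loose_empty_iff by simp_all
    then have "incident ?S \<subseteq> set es" by (auto simp: incident_def loose_def)
    then have inc: "card (incident ?S) \<le> k"
      using card_mono[of "set es" "incident ?S"] card_length[of es] P(2) by simp
    have "last vs \<noteq> hd vs"
    proof -
      have "distinct vs" "length vs = Suc k" using P by (auto simp: berge_path_def)
      then show ?thesis using vs_ne k1 by (simp add: hd_conv_nth last_conv_nth nth_eq_iff_index_eq)
    qed
    then have S: "card ?S = 2" by simp
    have "real (card (incident ?S)) \<le> weight_fn r k * real (card ?S)"
      using weight_large_ge[of k 2] pair rk inc S by simp
    moreover have "?S \<subseteq> V" using P(1) vs_ne by (auto simp: berge_path_def)
    moreover have "?S \<noteq> V" using S card_V r3 rk by auto
    moreover have "\<exists>ws fs. path ws fs \<and> length fs = k \<and> hd ws = v" if "v \<in> ?S" for v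
    proof (cases "v = hd vs")
      case False
      then have "hd (rev vs) = v" using that vs_ne by (simp add: hd_rev)
      then show ?thesis using berge_path_rev[OF P(1)] P(2) by (metis length_rev)
    qed (use P in blast)
    ultimately have "settled ?S" by (intro settled_proper[OF goodI]) (assumption | blast)+
    then show ?thesis by blast
  next
    case 2
    have "r - 1 > 0" using r3 by simp
    \<comment> \<open>The first vertex has no loose edge and lies on at most k - y path edges, where
      y is at least r - 1.\<close>
    then have "card (incident {hd vs}) \<le> k - r + 1"
      using deg counts 2 y_ge rk by (simp add: binomial_eq_0)
    then show ?thesis using settled_end[OF P] pair rk by simp
  next
    case 3
    have "card (incident {hd vs}) \<le> (k - x) + (x choose (r - 1))" using deg counts xy by linarith
    moreover have r: "r - 1 + 1 = r" using r3 by simp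
    have "r * ((k - x) + (x choose (r - 1))) \<le> k choose (r - 1)"
      by (rule choose_bound_half[of "r - 1" x k, unfolded r]) (use 3 x_ge counts xy in auto)
    ultimately show ?thesis using settled_end[OF P] rk by simp
  next
    case 4
    have x2: "2 \<le> x" using 4 x_ge by simp
    \<comment> \<open>If x + y < k, then x at most y gives 2x + 1 at most k; and x = 2, k = 5 leaves
      only y = 2.\<close>
    consider "x + y = k" | "2 * x + 1 \<le> k" "\<not> (x = 2 \<and> k = 5)" | "x = 2" "y = 2" "k = 5"
      using xy counts(2) x2 by linarith
    then show ?thesis
    proof cases
      case 1
      then have "card (incident {hd vs}) \<le> (x choose 2) + x - 1"
        using card_incident_hd_tight[OF P] 4 by (simp add: x_def y_def nh_def nl_def)
      then show ?thesis
        using settled_end[OF P] rk choose_two_bound_tight[OF x2, of k] 1 xy 4 by simp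
    next
      case 2
      have "card (incident {hd vs}) \<le> (k - x) + (x choose 2)" using deg counts xy 4 by simp
      then show ?thesis using settled_end[OF P] rk choose_two_bound_slack[OF x2 2] 4 by simp
    next
      case 3
      \<comment> \<open>The degree of one end may exceed f(5) here; the three ends reached by rotating along path edges
        compensate this on average.\<close>
      let ?X = "{i. i < k \<and> hd vs \<in> es ! i}"
      let ?S = "(!) vs ` ?X"
      have card_X: "card ?X \<le> 3" using counts(1) card_tight_nth[OF P] 3 by simp
      have ten: "k choose (r - 1) = 10" using 3 4 by (simp add: numeral_eq_Suc)
      \<comment> \<open>Rotating along path edges at the first vertex keeps the edge set, so all
        these ends have the same loose edges taken with respect to \<open>set es\<close>.\<close>
      have rot: "\<exists>vs' es'. path vs' es' \<and> length es' = k \<and> hd vs' = v \<and> last vs' = last vs \<and> set es' = set es"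
        if v: "v \<in> ?S" for v
      proof -
        obtain i where i: "i < k" "hd vs \<in> es ! i" "v = vs ! i" using v by blast
        moreover have "es ! i \<in> E" "vs ! Suc i \<in> es ! i" using P i(1) by (auto simp: berge_path_def)
        ultimately show ?thesis using path_rotate_nth[OF P(1), of i "es ! i"] P(2) by metis
      qed
      show ?thesis
      proof (cases "card ?X \<le> 2 \<or> (\<exists>v\<in>?S. 3 \<le> card (nbr (set es) v))")
        case True
        then show ?thesis
        proof
          assume "card ?X \<le> 2"
          \<comment> \<open>Two path edges and one loose edge; degree 3 suffices because 9 is at
            most 10.\<close>
          then have "card (incident {hd vs}) \<le> 3" using deg 3 4 card_tight_nth[OF P] by simp
          then show ?thesis using settled_end[OF P _ _, of 3] rk ten 4 by simp
        next
          assume "\<exists>v\<in>?S. 3 \<le> card (nbr (set es) v)"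
          then obtain vs' es' where P': "path vs' es'" "length es' = k" "last vs' = last vs"
            "set es' = set es" "3 \<le> card (nbr (set es) (hd vs'))"
            using rot by metis
          let ?vs = "rev vs'" and ?es = "rev es'"
          have Q: "path ?vs ?es" "length ?es = k" using berge_path_rev P'(1,2) by auto
          have hl: "hd ?vs = last vs" "last ?vs = hd vs'" using P'(3) by (simp_all add: hd_rev last_rev)
          \<comment> \<open>A large neighbourhood at a rotated end restricts the path edges at the
            common last vertex to 5 - 3.\<close>
          have "card {e \<in> set es. last vs \<in> e} \<le> 2"
            using end_counts(1)[OF Q] hl P'(4,5) 3 by simp
          moreover have "card (loose (set es) (last vs)) \<le> 1"
            using card_loose_le[of "set es" "last vs"] 3 4 by (simp add: y_def nl_def)
          ultimately have "card (incident {hd ?vs}) \<le> 3"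
            using card_incident_singleton[OF es_E, of "last vs"] hl by simp
          then show ?thesis using settled_end[OF Q, of 3] rk ten 4 by simp
        qed
      next
        case False
        then have "card ?X = 3" and small: "\<And>v. v \<in> ?S \<Longrightarrow> card (nbr (set es) v) \<le> 2"
          using card_X by force+
        have "inj_on ((!) vs) ?X"
          using P by (auto simp: inj_on_def nth_eq_iff_index_eq berge_path_def)
        then have S: "card ?S = 3" using \<open>card ?X = 3\<close> by (simp add: card_image)
        have loose1: "card (loose (set es) v) \<le> 1" if "v \<in> ?S" for v
        proof -
          have "card (nbr (set es) v) choose 2 \<le> 2 choose 2"
            using small[OF that] by (rule binomial_right_mono)
          then show ?thesis using card_loose_le[of "set es" v] 4 by simp
        qed
        have "incident ?S \<subseteq> set es \<union> (\<Union>v\<in>?S. loose (set es) v)"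
          by (auto simp: incident_def loose_def)
        moreover have "finite (\<Union>v\<in>?S. loose (set es) v)" using finE by (auto simp: loose_def)
        ultimately have "card (incident ?S) \<le> card (set es \<union> (\<Union>v\<in>?S. loose (set es) v))"
          by (intro card_mono) auto
        also have "\<dots> \<le> card (set es) + card (\<Union>v\<in>?S. loose (set es) v)" by (rule card_Un_le)
        also have "card (\<Union>v\<in>?S. loose (set es) v) \<le> (\<Sum>v\<in>?S. card (loose (set es) v))"
          by (intro card_UN_le) auto
        also have "\<dots> \<le> (\<Sum>v\<in>?S. 1)" using loose1 by (intro sum_mono)
        \<comment> \<open>Five path edges and one loose edge for each of three ends; 3 * 8 is at
          most 3 * 10.\<close>
        finally have "card (incident ?S) \<le> 8" using card_length[of es] P(2) 3 S by simp
        then have "real (card (incident ?S)) \<le> weight_fn r k * real (card ?S)"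
          using weight_large_ge[of 8 3] rk ten 4 S by simp
        moreover have "?S \<subseteq> V" using P by (fastforce simp: berge_path_def)
        moreover have "?S \<noteq> V" using S card_V 3 by auto
        moreover have "?S \<noteq> {}" using S by force
        moreover have "\<exists>ws fs. path ws fs \<and> length fs = k \<and> hd ws = v" if "v \<in> ?S" for v
          using rot[OF that] by metis
        ultimately have "settled ?S" by (intro settled_proper[OF goodI]) (assumption | blast)+
        then show ?thesis by blast
      qed
    qed
  qed
qed

end

section \<open>The inequality and its equality case\<close>

lemma (in max_berge) ex_settled:
  assumes "path vs es" "length es = k"
  shows "\<exists>S. settled S"
proof (cases "\<exists>vs es g. cycle vs es g \<and> length es = k")
  case True
  then show ?thesis using no_long_cycle_small settled_long_cycle by (metis not_le)
next
  case False
  then interpret max_berge_no_long r k V E by unfold_locales blast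
  consider "k = 1" | "2 \<le> k" "k \<le> r" | "r + 1 \<le> k" using k1 by linarith
  then show ?thesis
    by cases (use settled_single settled_small settled_large assms in blast)+
qed

definition edge_weight :: "nat \<Rightarrow> 'a set \<Rightarrow> 'a set set \<Rightarrow> 'a set \<Rightarrow> real" where
  "edge_weight r V E e = 1 / weight_fn r (real (max_berge_length V E e))"

text \<open>Take \<open>k\<close> to be the maximal path length of the whole hypergraph; the count
  in \<open>good\<close>, divided by f(k), is the sum of weights. Without edges \<open>V\<close>
  itself serves, with strict inequality.\<close>

lemma ex_reducing_set:
  assumes "3 \<le> r" "uniform_hypergraph r V E" "V \<noteq> {}"
  shows "\<exists>S. S \<subseteq> V \<and> S \<noteq> {} \<and>
    (\<Sum>e\<in>{e \<in> E. e \<inter> S \<noteq> {}}. edge_weight r V E e) \<le> real (card S) \<and>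
    (S = V \<and> (\<Sum>e\<in>{e \<in> E. e \<inter> S \<noteq> {}}. edge_weight r V E e) = real (card S) \<longrightarrow>
       all_ends V E \<and> extremal r V E)"
proof (cases "E = {}")
  case True
  have "card V > 0" using assms uniform_hypergraphD(1) by (metis card_gt_0_iff)
  then show ?thesis using True assms(3) by (intro exI[of _ V]) auto
next
  case False
  note H = uniform_hypergraphD[OF assms(2)]
  let ?K = "{length es |vs es. berge_path V E vs es}"
  have fin: "finite ?K"
    by (rule finite_subset[of _ "{..<card V}"]) (use berge_path_length_less[OF H(1)] in auto)
  obtain e where e: "e \<in> E" using False by blast
  then obtain vs es where vs: "berge_path V E vs es" "e \<in> set es"
    using max_berge_length_attained[OF assms(2)] assms(1) by (metis One_nat_def Suc_leD numeral_2_eq_2 numeral_3_eq_3)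
  then have "length es \<in> ?K" "1 \<le> length es" by (auto simp: Suc_le_eq)
  define k where "k = Max ?K"
  have "k \<in> ?K" "1 \<le> k"
    using Max_in[OF fin] Max_ge[OF fin \<open>length es \<in> ?K\<close>] \<open>length es \<in> ?K\<close> \<open>1 \<le> length es\<close>
    unfolding k_def by (blast, linarith)
  then obtain vs0 es0 where P0: "berge_path V E vs0 es0" "length es0 = k" by blast
  interpret max_berge r k V E
    using assms \<open>1 \<le> k\<close> Max_ge[OF fin] unfolding k_def by unfold_locales auto
  obtain S where S: "settled S" using ex_settled[OF P0] by blast
  have w: "weight_fn r (real k) > 0" using weight_fn_pos assms(1) k1 by blast
  have "(\<Sum>e\<in>incident S. edge_weight r V E e) = (\<Sum>e\<in>incident S. 1 / weight_fn r (real k))"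
    using S by (intro sum.cong) (auto simp: settled_def good_def edge_weight_def)
  then have sum: "(\<Sum>e\<in>{e \<in> E. e \<inter> S \<noteq> {}}. edge_weight r V E e) =
      real (card (incident S)) / weight_fn r (real k)"
    by (simp add: incident_def)
  show ?thesis
  proof (intro exI[of _ S] conjI)
    show "S \<subseteq> V" "S \<noteq> {}" using S by (auto simp: settled_def good_def)
  qed (use S w in \<open>auto simp: sum settled_def good_def field_simps\<close>)
qed

section \<open>Passing to subhypergraphs, and the induction\<close>

lemma max_berge_length_mono:
  assumes "uniform_hypergraph r V E" "uniform_hypergraph r V' E'" "V' \<subseteq> V" "E' \<subseteq> E" "2 \<le> r" "e \<in> E'"
  shows "max_berge_length V' E' e \<le> max_berge_length V E e"
proof -
  obtain vs es where "berge_path V' E' vs es" "e \<in> set es" "length es = max_berge_length V' E' e"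
    using max_berge_length_attained[OF assms(2,5,6)] .
  then show ?thesis
    using max_berge_length_ge[OF uniform_hypergraphD(1)[OF assms(1)]] berge_path_mono assms(3,4) by metis
qed

text \<open>The second part rests on the strict growth of f: equal weights leave no room for a
  longer path in the larger hypergraph.\<close>

lemma edge_weight_mono:
  assumes "uniform_hypergraph r V E" "uniform_hypergraph r V' E'" "V' \<subseteq> V" "E' \<subseteq> E" "3 \<le> r" "e \<in> E'"
  shows "edge_weight r V E e \<le> edge_weight r V' E' e"
    and "edge_weight r V E e = edge_weight r V' E' e \<Longrightarrow> max_berge_length V E e = max_berge_length V' E' e"
proof -
  let ?p = "max_berge_length V E e" and ?q = "max_berge_length V' E' e"
  have le: "?q \<le> ?p" using assms(5,6) by (intro max_berge_length_mono[OF assms(1-4)]) auto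
  have q: "1 \<le> ?q" using max_berge_length_pos[OF assms(2)] assms(5,6) by simp
  have w: "0 < weight_fn r (real ?q)" using weight_fn_pos assms(5) q by blast
  have less: "edge_weight r V E e < edge_weight r V' E' e" if "?q < ?p"
    using weight_fn_strict_mono[OF assms(5) q that] w
    unfolding edge_weight_def by (intro divide_strict_left_mono) auto
  show "edge_weight r V E e \<le> edge_weight r V' E' e"
    using less le by (cases "?q = ?p") (auto simp: edge_weight_def)
  show "?p = ?q" if "edge_weight r V E e = edge_weight r V' E' e" using less le that by linarith
qed

lemma sum_edge_weight_mono:
  assumes "uniform_hypergraph r V E" "uniform_hypergraph r V' E'" "V' \<subseteq> V" "E' \<subseteq> E" "3 \<le> r"
  shows "sum (edge_weight r V E) E' \<le> sum (edge_weight r V' E') E'"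
    and "sum (edge_weight r V E) E' = sum (edge_weight r V' E') E' \<Longrightarrow> e \<in> E' \<Longrightarrow>
      max_berge_length V E e = max_berge_length V' E' e"
proof -
  note m = edge_weight_mono[OF assms]
  show "sum (edge_weight r V E) E' \<le> sum (edge_weight r V' E') E'"
    using m(1) by (intro sum_mono)
  show "max_berge_length V E e = max_berge_length V' E' e"
    if "sum (edge_weight r V E) E' = sum (edge_weight r V' E') E'" "e \<in> E'"
    using sum_mono_inv[OF that(1) _ that(2)] m uniform_hypergraphD(2)[OF assms(2)] that(2) by blast
qed

lemma uniform_hypergraph_subset:
  "uniform_hypergraph r V E \<Longrightarrow> V' \<subseteq> V \<Longrightarrow> E' \<subseteq> E \<Longrightarrow> \<Union> E' \<subseteq> V' \<Longrightarrow> uniform_hypergraph r V' E'"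
  unfolding uniform_hypergraph_def hypergraph_def by (auto intro: finite_subset)

lemma all_endsE:
  assumes "all_ends V E" "w \<in> V"
  obtains e vs es where "e \<in> E" "berge_path V E vs es" "hd vs = w" "e \<in> set es"
    "length es = max_berge_length V E e"
  using assms unfolding all_ends_def by blast

text \<open>Equality makes every estimate in the chain tight, so lengths for edges off
  \<open>S\<close> are unchanged by the deletion. A crossing edge would extend a maximal path of the
  rest that starts at its outer vertex by a vertex of \<open>S\<close>. The facts about the rest are
  assumptions since they serve once as induction hypothesis and once as finished result.\<close>

lemma no_crossing_edge:
  assumes r: "3 \<le> r" and H: "uniform_hypergraph r V E" and S: "S \<subseteq> V"
    and red: "(\<Sum>e\<in>{e \<in> E. e \<inter> S \<noteq> {}}. edge_weight r V E e) \<le> real (card S)"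
    and eq: "sum (edge_weight r V E) E = real (card V)"
    and rest: "sum (edge_weight r (V - S) {e \<in> E. e \<inter> S = {}}) {e \<in> E. e \<inter> S = {}} \<le> real (card (V - S))"
      "sum (edge_weight r (V - S) {e \<in> E. e \<inter> S = {}}) {e \<in> E. e \<inter> S = {}} = real (card (V - S)) \<longrightarrow>
        all_ends (V - S) {e \<in> E. e \<inter> S = {}}"
  shows "(\<Sum>e\<in>{e \<in> E. e \<inter> S \<noteq> {}}. edge_weight r V E e) = real (card S)"
    and "\<And>e. e \<in> E \<Longrightarrow> e \<subseteq> S \<or> e \<inter> S = {}"
    and "all_ends (V - S) {e \<in> E. e \<inter> S = {}}"
    and "\<And>e. e \<in> E \<Longrightarrow> e \<inter> S = {} \<Longrightarrow>
      max_berge_length V E e = max_berge_length (V - S) {e \<in> E. e \<inter> S = {}} e"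
proof -
  let ?E = "{e \<in> E. e \<inter> S = {}}" and ?I = "{e \<in> E. e \<inter> S \<noteq> {}}"
  note D = uniform_hypergraphD[OF H]
  have H': "uniform_hypergraph r (V - S) ?E"
    using D(3) by (intro uniform_hypergraph_subset[OF H]) auto
  have "E = ?I \<union> ?E" by blast
  then have "sum (edge_weight r V E) E = sum (edge_weight r V E) ?I + sum (edge_weight r V E) ?E"
    using D(2) by (subst sum.union_disjoint[symmetric]) auto
  moreover have "real (card V) = real (card S) + real (card (V - S))"
    using S D(1) by (simp add: card_Diff_subset finite_subset card_mono of_nat_diff)
  moreover note mono = sum_edge_weight_mono[OF H H' _ _ r]
  have "sum (edge_weight r V E) ?E \<le> sum (edge_weight r (V - S) ?E) ?E" by (rule mono) auto
  ultimately have I: "sum (edge_weight r V E) ?I = real (card S)"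
    and e1: "sum (edge_weight r V E) ?E = sum (edge_weight r (V - S) ?E) ?E"
    and e2: "sum (edge_weight r (V - S) ?E) ?E = real (card (V - S))"
    using red eq rest(1) by linarith+
  show "sum (edge_weight r V E) ?I = real (card S)" by (rule I)
  show p: "max_berge_length V E e = max_berge_length (V - S) ?E e" if "e \<in> E" "e \<inter> S = {}" for e
    by (rule mono(2)[OF _ _ e1]) (use that in auto)
  show ends: "all_ends (V - S) ?E" using rest(2) e2 by blast
  show "e \<subseteq> S \<or> e \<inter> S = {}" if e: "e \<in> E" for e
  proof (rule ccontr)
    assume "\<not> (e \<subseteq> S \<or> e \<inter> S = {})"
    then obtain u w where uw: "u \<in> e" "u \<in> S" "w \<in> e" "w \<in> V - S" using D(3)[OF e] by blast
    obtain f vs es where f: "f \<in> ?E" "berge_path (V - S) ?E vs es" "hd vs = w" "f \<in> set es"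
      "length es = max_berge_length (V - S) ?E f"
      by (rule all_endsE[OF ends uw(4)])
    have "berge_path V E vs es" using berge_path_mono[OF f(2)] by blast
    moreover have "u \<notin> set vs" "e \<notin> set es" using f(2) uw by (auto simp: berge_path_def)
    ultimately have "berge_path V E (u # vs) (e # es)"
      using uw f(3) S e by (intro berge_path_Cons) auto
    then have "length (e # es) \<le> max_berge_length V E f"
      using f(4) by (intro max_berge_length_ge[OF D(1)]) auto
    then show False using p[of f] f(1,5) by simp
  qed
qed

lemma all_ends_transfer:
  assumes "all_ends V' E'" "V' \<subseteq> V" "E' \<subseteq> E" "w \<in> V'"
    "\<And>e. e \<in> E' \<Longrightarrow> max_berge_length V E e = max_berge_length V' E' e"
  shows "\<exists>e\<in>E. \<exists>vs es. berge_path V E vs es \<and> hd vs = w \<and> e \<in> set es \<and> length es = max_berge_length V E e"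
proof -
  obtain e vs es where "e \<in> E'" "berge_path V' E' vs es" "hd vs = w" "e \<in> set es"
    "length es = max_berge_length V' E' e"
    by (rule all_endsE[OF assms(1,4)])
  then show ?thesis using berge_path_mono[OF _ assms(2,3)] assms(3,5) by (metis subsetD)
qed

lemma sum_edge_weight_le:
  assumes "3 \<le> r" "uniform_hypergraph r V E"
  shows "sum (edge_weight r V E) E \<le> real (card V) \<and>
    (sum (edge_weight r V E) E = real (card V) \<longrightarrow> all_ends V E)"
  using assms(2)
proof (induction "card V" arbitrary: V E rule: less_induct)
  case less
  note H = less.prems
  note D = uniform_hypergraphD[OF H]
  show ?case
  proof (cases "V = {}")
    case True
    then have "E = {}" using D(3,4) assms(1) by fastforce
    then show ?thesis using True by (simp add: all_ends_def)
  next
    case False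
    then obtain S where S: "S \<subseteq> V" "S \<noteq> {}"
      and red: "(\<Sum>e\<in>{e \<in> E. e \<inter> S \<noteq> {}}. edge_weight r V E e) \<le> real (card S)"
      and full: "S = V \<and> (\<Sum>e\<in>{e \<in> E. e \<inter> S \<noteq> {}}. edge_weight r V E e) = real (card S) \<longrightarrow> all_ends V E"
      using ex_reducing_set[OF assms(1) H] by blast
    let ?E = "{e \<in> E. e \<inter> S = {}}" and ?I = "{e \<in> E. e \<inter> S \<noteq> {}}"
    have H': "uniform_hypergraph r (V - S) ?E"
      using D(3) by (intro uniform_hypergraph_subset[OF H]) auto
    have smaller: "card (V - S) < card V" using S D(1) by (intro psubset_card_mono) auto
    note IH = less.hyps[OF smaller H']
    have split: "sum (edge_weight r V E) E = sum (edge_weight r V E) ?I + sum (edge_weight r V E) ?E"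
    proof -
      have "E = ?I \<union> ?E" by blast
      then show ?thesis using D(2) by (subst sum.union_disjoint[symmetric]) auto
    qed
    have card_V: "real (card V) = real (card S) + real (card (V - S))"
      using S(1) D(1) by (simp add: card_Diff_subset finite_subset card_mono of_nat_diff)
    have "sum (edge_weight r V E) ?E \<le> sum (edge_weight r (V - S) ?E) ?E"
      by (rule sum_edge_weight_mono[OF H H' _ _ assms(1)]) auto
    then have le: "sum (edge_weight r V E) E \<le> real (card V)" using split card_V red IH by linarith
    have "all_ends V E" if eq: "sum (edge_weight r V E) E = real (card V)"
    proof -
      note nc = no_crossing_edge[OF assms(1) H S(1) red eq IH[THEN conjunct1] IH[THEN conjunct2]]
      show ?thesis
      proof (cases "S = V")
        case True
        then show ?thesis using full nc(1) by blast
      next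
        case False
        then have "card S < card V" using S(1) D(1) by (intro psubset_card_mono) auto
        have HS: "uniform_hypergraph r S ?I"
          \<comment> \<open>No edge crosses, so the edges meeting \<open>S\<close> form a hypergraph
            on \<open>S\<close>, which is smaller than \<open>V\<close>; the induction hypothesis is
            used for it a second time.\<close>
          using nc(2) by (intro uniform_hypergraph_subset[OF H S(1)]) auto
        note IS = less.hyps[OF \<open>card S < card V\<close> HS]
        note mono = sum_edge_weight_mono[OF H HS S(1) _ assms(1)]
        have "sum (edge_weight r V E) ?I \<le> sum (edge_weight r S ?I) ?I" by (rule mono) auto
        then have eqS: "sum (edge_weight r V E) ?I = sum (edge_weight r S ?I) ?I"
          and "all_ends S ?I" using IS nc(1) by auto
        have pS: "max_berge_length V E e = max_berge_length S ?I e" if "e \<in> ?I" for e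
          by (rule mono(2)[OF _ eqS that]) auto
        show ?thesis
          unfolding all_ends_def
        proof
          fix w assume "w \<in> V"
          show "\<exists>e\<in>E. \<exists>vs es. berge_path V E vs es \<and> hd vs = w \<and> e \<in> set es \<and>
              length es = max_berge_length V E e"
          proof (cases "w \<in> S")
            case True
            show ?thesis
              by (rule all_ends_transfer[OF \<open>all_ends S ?I\<close> S(1) _ True pS]) auto
          next
            case False
            show ?thesis
              by (rule all_ends_transfer[OF nc(3), of V E w]) (use False \<open>w \<in> V\<close> nc(4) in auto)
          qed
        qed
      qed
    qed
    then show ?thesis using le by blast
  qed
qed

lemma connected_crossing:
  assumes "hypergraph_connected V E" "S \<subseteq> V" "S \<noteq> {}" "S \<noteq> V"
  obtains e where "e \<in> E" "e \<inter> S \<noteq> {}" "\<not> e \<subseteq> S"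
proof -
  obtain u v where uv: "u \<in> S" "v \<in> V" "v \<notin> S" using assms by blast
  then obtain vs es where P: "berge_path V E vs es" "hd vs = u" "last vs = v"
    using assms unfolding hypergraph_connected_def by (metis subsetD)
  have "links vs es \<Longrightarrow> hd vs \<in> S \<Longrightarrow> last vs \<notin> S \<Longrightarrow> \<exists>e\<in>set es. e \<inter> S \<noteq> {} \<and> \<not> e \<subseteq> S"
    by (induction vs es rule: links.induct) (auto split: if_splits)
  then show ?thesis using that P uv by (auto simp: berge_path_iff_links)
qed

lemma extremal_if_equality:
  assumes "3 \<le> r" "uniform_hypergraph r V E" "hypergraph_connected V E" "V \<noteq> {}"
    "sum (edge_weight r V E) E = real (card V)"
  shows "extremal r V E"
proof -
  note H = assms(2)
  note D = uniform_hypergraphD[OF H]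
  obtain S where S: "S \<subseteq> V" "S \<noteq> {}"
    and red: "(\<Sum>e\<in>{e \<in> E. e \<inter> S \<noteq> {}}. edge_weight r V E e) \<le> real (card S)"
    and full: "S = V \<and> (\<Sum>e\<in>{e \<in> E. e \<inter> S \<noteq> {}}. edge_weight r V E e) = real (card S) \<longrightarrow> extremal r V E"
    using ex_reducing_set[OF assms(1) H assms(4)] by blast
  have H': "uniform_hypergraph r (V - S) {e \<in> E. e \<inter> S = {}}"
    using D(3) by (intro uniform_hypergraph_subset[OF H]) auto
  note IH = sum_edge_weight_le[OF assms(1) H']
  note nc = no_crossing_edge[OF assms(1) H S(1) red assms(5) IH[THEN conjunct1] IH[THEN conjunct2]]
  have "S = V" using connected_crossing[OF assms(3) S] nc(2) by metis
  then show ?thesis using full nc(1) by blast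
qed

section \<open>The extremal hypergraphs attain equality\<close>

lemma finite_complete_uniform_edges: "finite V \<Longrightarrow> finite (complete_uniform_edges r V)"
  by (rule finite_subset[of _ "Pow V"]) (auto simp: complete_uniform_edges_def)

lemma uniform_subset_complete:
  "uniform_hypergraph r V E \<Longrightarrow> E \<subseteq> complete_uniform_edges r V"
  using uniform_hypergraphD(3,4) by (fastforce simp: complete_uniform_edges_def)

text \<open>The windows of r cyclically consecutive vertices are distinct because r is less than the
  number of vertices.\<close>

lemma complete_spanning_cycle:
  assumes "finite V" "2 \<le> r" "r < card V"
  obtains vs es g where "berge_cycle V (complete_uniform_edges r V) vs es g"
    "length es = card V - 1" "set vs = V"
proof -
  let ?n = "card V"
  obtain vs where vs: "set vs = V" "distinct vs" using finite_distinct_list[OF assms(1)] by blast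
  have len: "length vs = ?n" using vs by (metis distinct_card)
  \<comment> \<open>Addition of positions modulo the number of vertices, written out so that linear
    arithmetic applies.\<close>
  define shift where "shift i j = (if i + j < ?n then i + j else i + j - ?n)" for i j :: nat
  define win where "win i = shift i ` {..<r}" for i
  define edge where "edge i = (!) vs ` win i" for i
  have shift_less: "shift i j < ?n" if "i < ?n" "j < r" for i j
    using that assms(3) by (auto simp: shift_def)
  then have win_sub: "win i \<subseteq> {..<?n}" if "i < ?n" for i using that by (auto simp: win_def)
  have inj_vs: "inj_on ((!) vs) {..<?n}" using vs(2) len by (simp add: inj_on_nth)
  have edge: "edge i \<in> complete_uniform_edges r V" if "i < ?n" for i
  proof -
    have "inj_on (shift i) {..<r}"
      using that assms(3) by (auto simp: inj_on_def shift_def split: if_splits)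
    then have "card (win i) = r" by (simp add: win_def card_image)
    moreover have "inj_on ((!) vs) (win i)" using inj_vs win_sub[OF that] inj_on_subset by blast
    moreover have "edge i \<subseteq> V"
      using win_sub[OF that] vs(1) len unfolding edge_def by (metis image_subset_iff lessThan_iff nth_mem subsetD)
    ultimately show ?thesis by (simp add: complete_uniform_edges_def edge_def card_image)
  qed
  have mem: "vs ! i \<in> edge i" "vs ! (if Suc i < ?n then Suc i else 0) \<in> edge i" if "i < ?n" for i
  proof -
    have "i = shift i 0" "(if Suc i < ?n then Suc i else 0) = shift i 1"
      using that by (auto simp: shift_def)
    then have "i \<in> win i" "(if Suc i < ?n then Suc i else 0) \<in> win i"
      using assms(2) unfolding win_def by (metis imageI lessThan_iff less_le_trans pos2, metis imageI lessThan_iff less_le_trans one_less_numeral_iff semiring_norm(76))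
    then show "vs ! i \<in> edge i" "vs ! (if Suc i < ?n then Suc i else 0) \<in> edge i"
      unfolding edge_def by blast+
  qed
  have inj_edge: "inj_on edge {..<?n}"
  proof (rule inj_onI)
    fix i i' assume i: "i \<in> {..<?n}" "i' \<in> {..<?n}" and eq: "edge i = edge i'"
    have "win i = win i'"
      using eq inj_on_image_eq_iff[OF inj_vs win_sub win_sub] i by (simp add: edge_def)
    show "i = i'"
    proof (rule ccontr)
      assume "i \<noteq> i'"
      have "shift i 0 \<in> win i" using assms(2) unfolding win_def by (intro imageI) auto
      then have "i \<in> win i'" using \<open>win i = win i'\<close> i by (simp add: shift_def)
      then obtain j where j: "j < r" "i = shift i' j" by (auto simp: win_def)
      then have "j \<noteq> 0" using \<open>i \<noteq> i'\<close> i by (intro notI) (simp add: shift_def)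
      \<comment> \<open>The cyclic predecessor of \<open>i\<close> would belong to the window
        starting at \<open>i\<close>, hence r would be at least the number of vertices.\<close>
      then have "shift i' (j - 1) \<in> win i" using j \<open>win i = win i'\<close> by (auto simp: win_def)
      then obtain j2 where "j2 < r" "shift i' (j - 1) = shift i j2" by (auto simp: win_def)
      then show False
        using j \<open>j \<noteq> 0\<close> i assms(3) by (auto simp: shift_def split: if_splits)
    qed
  qed
  let ?es = "map edge [0..<?n - 1]"
  have n: "?n \<ge> 1" using assms by simp
  have "berge_path V (complete_uniform_edges r V) vs ?es"
    unfolding berge_path_def
  proof (intro conjI allI impI)
    show "distinct ?es"
      unfolding distinct_map by (auto intro: inj_on_subset[OF inj_edge])
    show "set ?es \<subseteq> complete_uniform_edges r V" using edge by auto
    fix i assume "i < length ?es"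
    then have "i < ?n" "Suc i < ?n" by auto
    then show "vs ! i \<in> ?es ! i" "vs ! Suc i \<in> ?es ! i"
      using mem[of i] by (simp_all add: nth_append)
  qed (use vs len n in auto)
  moreover have "edge (?n - 1) \<in> complete_uniform_edges r V" using edge n by simp
  moreover have "edge (?n - 1) \<notin> set ?es"
  proof
    assume "edge (?n - 1) \<in> set ?es"
    then obtain i where i: "i < ?n - 1" "edge (?n - 1) = edge i" by auto
    moreover have "i < ?n" "?n - 1 < ?n" using i(1) n by linarith+
    ultimately have "?n - 1 = i" using inj_onD[OF inj_edge i(2)] by simp
    then show False using i(1) by simp
  qed
  moreover have "vs \<noteq> []" using len n by auto
  then have "hd vs \<in> edge (?n - 1)" "last vs \<in> edge (?n - 1)"
    using mem[of "?n - 1"] n len by (simp_all add: hd_conv_nth last_conv_nth)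
  ultimately have "berge_cycle V (complete_uniform_edges r V) vs ?es (edge (?n - 1))"
    by (simp add: berge_cycle_def)
  then show ?thesis using that vs(1) by simp
qed

text \<open>A spanning cycle puts every edge on a path of the greatest conceivable length, the
  number of vertices minus one; the identity behind f then gives the sum.\<close>

lemma sum_edge_weight_complete:
  assumes r: "3 \<le> r" "r < card V" and H: "uniform_hypergraph r V (complete_uniform_edges r V)"
  shows "sum (edge_weight r V (complete_uniform_edges r V)) (complete_uniform_edges r V) = real (card V)"
proof -
  let ?E = "complete_uniform_edges r V" and ?k = "card V - 1"
  note fin = uniform_hypergraphD(1)[OF H]
  interpret max_berge r ?k V ?E
    using r H berge_path_length_less[OF fin] by unfold_locales fastforce+
  obtain vs es g where cyc: "cycle vs es g" "length es = ?k" "set vs = V"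
    using complete_spanning_cycle[OF fin] r by (metis One_nat_def Suc_leD numeral_2_eq_2 numeral_3_eq_3)
  have "p e = ?k" if "e \<in> ?E" for e
    using p_long_cycle[OF cyc(1,2) that] cyc(3) sub[OF that] edge_not_empty[OF that] by blast
  then have "sum (edge_weight r V ?E) ?E = (\<Sum>e\<in>?E. 1 / weight_fn r (real ?k))"
    by (intro sum.cong) (auto simp: edge_weight_def)
  also have "\<dots> = real (card V choose r) / (real (?k choose (r - 1)) / real r)"
    using n_subsets[OF fin, of r] weight_fn_large[of r ?k] r by (simp add: complete_uniform_edges_def)
  also have "\<dots> = real (card V)"
  proof -
    have "r * (card V choose r) = card V * (?k choose (r - 1))"
      using r Suc_times_binomial_eq[of ?k "r - 1"] by (simp add: mult.commute)
    then have "real r * real (card V choose r) = real (card V) * real (?k choose (r - 1))"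
      by (metis of_nat_mult)
    moreover have "real (?k choose (r - 1)) > 0" using r by simp
    ultimately show ?thesis using r by (simp add: field_simps)
  qed
  finally show ?thesis .
qed

lemma sum_edge_weight_single:
  assumes r: "3 \<le> r" and H: "uniform_hypergraph r V {e}"
  shows "sum (edge_weight r V {e}) {e} = real r"
proof -
  obtain vs es where *: "berge_path V {e} vs es" "e \<in> set es" "length es = max_berge_length V {e} e"
    using max_berge_length_attained[OF H, of e] r by auto
  then have "card (set es) \<le> 1" by (auto simp: berge_path_def intro: order_trans[OF card_mono[of "{e}"]])
  then have "length es \<le> 1" using * by (simp add: berge_path_def distinct_card)
  then have "max_berge_length V {e} e = 1"
    using max_berge_length_pos[OF H, of e] * r by simp
  then show ?thesis by (simp add: edge_weight_def weight_fn_1)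
qed

text \<open>The edges are the complements of the vertices in a set M; two vertices outside M start a path in
  which the edge missing a vertex of M is used two steps before that vertex is reached.\<close>

lemma path_through_all_edges:
  assumes H: "uniform_hypergraph r V E" and n: "card V = r + 1" and E: "card E < r"
  obtains vs es where "berge_path V E vs es" "set es = E"
proof -
  note D = uniform_hypergraphD[OF H]
  define M where "M = {w \<in> V. V - {w} \<in> E}"
  have image: "(\<lambda>w. V - {w}) ` M = E"
  proof (intro equalityI subsetI)
    fix e assume e: "e \<in> E"
    then have "card (V - e) = 1" using D n by (simp add: card_Diff_subset)
    then obtain w where w: "V - e = {w}" using card_1_singletonE by blast
    then have "e = V - {w}" "w \<in> V" using D(3)[OF e] by blast+
    then show "e \<in> (\<lambda>w. V - {w}) ` M" using e by (auto simp: M_def)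
  qed (auto simp: M_def)
  have inj: "inj_on (\<lambda>w. V - {w}) M" by (auto simp: inj_on_def M_def)
  have MV: "M \<subseteq> V" "finite M" using D(1) finite_subset by (auto simp: M_def)
  have "card M = card E" using image inj card_image by metis
  \<comment> \<open>Here fewer than r edges are essential to the construction: r edges would leave
    only one vertex outside \<open>M\<close>.\<close>
  then have "\<not> card (V - M) \<le> 1" using MV E n by (simp add: card_Diff_subset)
  then obtain a b where ab: "a \<in> V - M" "b \<in> V - M" "a \<noteq> b"
    using card_le_Suc0_iff_eq[of "V - M"] D(1) by auto
  obtain ws where ws: "set ws = M" "distinct ws" using finite_distinct_list[OF MV(2)] by blast
  let ?us = "a # b # ws"
  \<comment> \<open>The i-th edge misses only entry i + 2 of \<open>?us\<close>, so it joins entries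
    i and i + 1; the path stops one entry before the end of \<open>?us\<close>.\<close>
  let ?vs = "take (Suc (length ws)) ?us" and ?es = "map (\<lambda>w. V - {w}) ws"
  have us: "distinct ?us" "set ?us \<subseteq> V" using ab ws MV by auto
  have "?us ! i \<in> V - {ws ! i}" "?us ! Suc i \<in> V - {ws ! i}" if i: "i < length ws" for i
  proof -
    have "ws ! i = ?us ! Suc (Suc i)" by simp
    moreover have "?us ! i \<noteq> ?us ! Suc (Suc i)" "?us ! Suc i \<noteq> ?us ! Suc (Suc i)"
      using i us(1) by (simp_all only: nth_eq_iff_index_eq length_Cons)
    moreover have "?us ! i \<in> V" "?us ! Suc i \<in> V"
      using i us(2) nth_mem[of i ?us] nth_mem[of "Suc i" ?us] by auto
    ultimately show "?us ! i \<in> V - {ws ! i}" "?us ! Suc i \<in> V - {ws ! i}" by auto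
  qed
  moreover have "set ?vs \<subseteq> V" using us(2) set_take_subset by (metis order_trans)
  moreover have "distinct ?vs" using us(1) distinct_take by blast
  moreover have "distinct ?es" "set ?es = E" using inj ws image by (auto simp: distinct_map)
  ultimately have "berge_path V E ?vs ?es" by (auto simp: berge_path_def simp del: nth_Cons_Suc take_Suc_Cons)
  then show ?thesis using that \<open>set ?es = E\<close> by blast
qed

text \<open>All m edges lie on one path and none is longer, so p = m throughout, and m weights (r +
  1)/m add up to r + 1.\<close>

lemma sum_edge_weight_few_edges:
  assumes r: "3 \<le> r" and H: "uniform_hypergraph r V E" and n: "card V = r + 1"
    and E: "2 \<le> card E" "card E < r"
  shows "sum (edge_weight r V E) E = real (card V)"
proof -
  note D = uniform_hypergraphD[OF H]
  obtain vs es where P: "berge_path V E vs es" "set es = E" using path_through_all_edges[OF H n E(2)] .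
  have len: "length es = card E" using P by (metis berge_path_def distinct_card)
  have "max_berge_length V E e = card E" if e: "e \<in> E" for e
  proof -
    obtain vs' es' where "berge_path V E vs' es'" "length es' = max_berge_length V E e"
      using max_berge_length_attained[OF H _ e] r by (metis One_nat_def Suc_leD numeral_2_eq_2 numeral_3_eq_3)
    then have "max_berge_length V E e \<le> card E"
      using card_mono[OF D(2), of "set es'"] by (metis berge_path_def distinct_card)
    then show ?thesis using max_berge_length_ge[OF D(1) P(1)] P(2) e len by fastforce
  qed
  then have "sum (edge_weight r V E) E = (\<Sum>e\<in>E. 1 / weight_fn r (real (card E)))"
    by (intro sum.cong) (auto simp: edge_weight_def)
  also have "\<dots> = real (card V)"
    using E n by (subst weight_fn_small) (auto simp: field_simps)
  finally show ?thesis .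
qed

lemma sum_edge_weight_extremal:
  assumes r: "3 \<le> r" "r \<le> card V" and H: "uniform_hypergraph r V E"
    and con: "hypergraph_connected V E" and ext: "extremal r V E"
  shows "sum (edge_weight r V E) E = real (card V)"
proof -
  note D = uniform_hypergraphD[OF H]
  consider "E = complete_uniform_edges r V" "card V = r" | "E = complete_uniform_edges r V" "r < card V"
    | "card V = r + 1" "card E = r + 1" | "card V = r + 1" "card E = 1"
    | "card V = r + 1" "2 \<le> card E" "card E < r"
    using ext r unfolding extremal_def by fastforce
  then show ?thesis
  proof cases
    case 1
    then have "E = {V}"
      using card_subset_eq[OF D(1)] by (auto simp: complete_uniform_edges_def)
    then show ?thesis using sum_edge_weight_single[OF r(1)] H 1 by simp
  next
    case 2
    then show ?thesis using sum_edge_weight_complete[OF r(1)] H by simp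
  next
    case 3
    have "card (complete_uniform_edges r V) = r + 1"
      using n_subsets[OF D(1), of r] 3 by (simp add: complete_uniform_edges_def)
    then have "E = complete_uniform_edges r V"
      using card_subset_eq[OF finite_complete_uniform_edges[OF D(1)] uniform_subset_complete[OF H]] 3 by simp
    then show ?thesis using sum_edge_weight_complete[OF r(1), of V] H 3(1) by simp
  next
    case 4
    then obtain e where e: "E = {e}" using card_1_singletonE by blast
    \<comment> \<open>A single edge misses one of the r + 1 vertices, against connectedness.\<close>
    have "e \<subseteq> V" "e \<noteq> {}" "e \<noteq> V" using D(3,4)[of e] e 4 r by auto
    then show ?thesis using connected_crossing[OF con] e by blast
  next
    case 5
    then show ?thesis using sum_edge_weight_few_edges[OF r(1) H] by simp
  qed
qed

theorem theorem2p1: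
  fixes n r :: nat and V :: "'a set" and E :: "'a set set"
  assumes "3 \<le> r" and "r \<le> n"
    and "uniform_hypergraph r V E"
    and "card V = n"
    and "hypergraph_connected V E"
  shows "(\<Sum>e\<in>E. 1 / weight_fn r (real (max_berge_length V E e))) \<le> real n \<and>
    ((\<Sum>e\<in>E. 1 / weight_fn r (real (max_berge_length V E e))) = real n \<longleftrightarrow>
       (n = r + 1 \<and> card E \<in> {1..r - 1} \<union> {r + 1}) \<or>
       (n \<noteq> r + 1 \<and> E = complete_uniform_edges r V))"
proof -
  have "V \<noteq> {}" using assms by auto
  then have "sum (edge_weight r V E) E = real (card V) \<longleftrightarrow> extremal r V E"
    using extremal_if_equality[OF assms(1,3,5)] sum_edge_weight_extremal[OF assms(1) _ assms(3,5)] assms(2,4)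
    by blast
  then show ?thesis
    using sum_edge_weight_le[OF assms(1,3)] assms(4) by (simp add: edge_weight_def extremal_def)
qed

end
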